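(* Let $D$ be an $n$-component virtual link diagram obtained from an almost classical virtual link diagram by virtualizing a classical crossing (i.e. replacing a classical crossing with a virtual crossing). Then $$\mathrm{Exp}(X_D)\subset\begin{cases}4\mathbb{Z} & (n \text{ odd}),\\ 4\mathbb{Z}+2 & (n\text{ even}),\end{cases}\qquad \mathrm{Exp}(X_D|d_1)\subset\begin{cases}4\mathbb{Z}+2 & (n \text{ odd}),\\ 4\mathbb{Z} & (n\text{ even}),\end{cases}$$ where $X_D$ is the multivariable polynomial of $D$.
   Context: **Exponent sets.** For $g\in\mathbb{Z}[A^{\pm1},d_1,d_2,\dots]$, $\mathrm{Exp}(g)$ is the set of integers appearing as exponents of $A$ in the terms of $g$ (with nonzero coefficient) containing no $d_i$, and $\mathrm{Exp}(g|d_i)$ is the set of integers appearing as exponents of $A$ in the terms of $g$ (with nonzero coefficient) containing $d_i$. **Virtual link diagrams.** A virtual link diagram is a (nonempty, finite) collection of immersed oriented loops in $\mathbb{R}^2$ (its components) whose multiple points are transverse double points, each being either a classical crossing (with over/under information, and hence positive or negative in the usual sense) or a virtual crossing (no over/under information). The writhe $w(D)$ is the number of positive crossings minus the number of negative crossings of $D$. **Alexander numberings.** A semi-arc of $D$ is an immersed arc in a component of $D$ between two (consecutive) classical crossings, or an immersed loop of $D$ missing classical crossings; semi-arcs pass through virtual crossings. An Alexander numbering of $D$ is an assignment of an integer to each semi-arc such that at each classical crossing, drawn with both strands oriented upward, there is some $i\in\mathbb{Z}$ such that the two left semi-arcs (bottom-left and top-left) are numbered $i$ and the two right semi-arcs (bottom-right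 and top-right) are numbered $i+1$, regardless of the sign of the crossing. $D$ is almost classical if it admits an Alexander numbering. **Cut systems.** An oriented cut point is a point on a semi-arc of $D$ (away from crossings) together with a choice of one of the two directions along the semi-arc (which need not agree with the orientation of $D$). A cut system of $D$ is a finite set $C$ of oriented cut points such that $D$ with $C$ admits an Alexander numbering, i.e. integers can be assigned to the pieces of semi-arcs cut at the cut points so that at each classical crossing, drawn with both strands oriented upward, there is some $i\in\mathbb{Z}$ such that the two left pieces (bottom-left and top-left) are numbered $i$ and the two right pieces (bottom-right and top-right) are numbered $i+1$ (regardless of the sign of the crossing), numbers are unchanged through virtual crossings, and the number increases by $1$ when one passes a cut point in the direction of that cut point. Every virtual link diagram has a cut system; the empty set is a cut system of an almost classical diagram. **States and indices.** At a positive crossing the A-splice is the orientation-respecting smoothing and the B-splice is the other smoothing; at a negative crossing the B-splice is the orientation-respecting smoothing and the A-splice is the other one. A state $\sigma$ of $(D,C)$ is the union of immersed loops in $\mathbb{R}^2$, with virtual crossings and oriented cut points, obtained by choosing an A- or B-splice at every classical crossing of $D$. For a loop $\ell$ of a state, its index $\iota(\ell)\ge 0$ is determined by: virtual crossings are ignored; two adjacent cut points of $\ell$ with opposite directions along $\ell$ may be cancelled; a loop with $2r$ cut points all in the same direction along the loop has index $r$. Equivalently, $\iota(\ell)$ is half the absolute value of the number of cut points of $\ell$ pointing in one direction along $\ell$ minus the number pointing in the other direction (this difference is always even). Let $\natural\sigma$ be the number of A-splices minus the number of B-splices used to obtain $\sigma$, $\sharp\sigma$ the number of loops of $\sigma$,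 and $\tau_i(\sigma)$ the number of loops of $\sigma$ of index $i$. **The polynomial.** The double bracket is $$\langle\!\langle D,C\rangle\!\rangle=\sum_{\sigma}A^{\natural\sigma}(-A^2-A^{-2})^{\sharp\sigma-1}d_1^{\tau_1(\sigma)}d_2^{\tau_2(\sigma)}\cdots\in\mathbb{Z}[A^{\pm1},d_1,d_2,\dots],$$ the sum running over all states $\sigma$ of $(D,C)$. It is known (N. Kamada) not to depend on the choice of the cut system $C$, so write $\langle\!\langle D\rangle\!\rangle$. The multivariable polynomial of $D$ is $X_D=(-A^3)^{-w(D)}\langle\!\langle D\rangle\!\rangle$; it is an invariant of virtual links. *)

theory Defs
  imports
    "HOL-Analysis.Analysis"
    "HOL-Combinatorics.Orbits"
    "HOL-Library.Poly_Mapping"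
begin

section \<open>Virtual link diagrams\<close>

text \<open>
  A loop is given by a parametrisation of period 1, so that \<open>(i, t)\<close> with \<open>i < components D\<close> and
  \<open>0 \<le> t < 1\<close> runs over the points of the oriented loops before they are immersed in the plane.
  A crossing is a double point \<open>p\<close> in the plane: \<open>over D p = None\<close> means that it is
  virtual, and \<open>over D p = Some x\<close> that it is classical and that the strand through \<open>x\<close> is the
  over-strand.
\<close>

type_synonym plane = "real \<times> real"
type_synonym point = "nat \<times> real"

record diagram =
  components :: nat
  curve :: "nat \<Rightarrow> real \<Rightarrow> plane"
  over :: "plane \<Rightarrow> point option"

definition points :: "diagram \<Rightarrow> point set" where
  "points D = {(i, t). i < components D \<and> 0 \<le> t \<and> t < 1}"

definition position :: "diagram \<Rightarrow> point \<Rightarrow> plane" where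
  "position D x = curve D (fst x) (snd x)"

definition velocity :: "diagram \<Rightarrow> point \<Rightarrow> plane" where
  "velocity D x = vector_derivative (curve D (fst x)) (at (snd x))"

definition preimages :: "diagram \<Rightarrow> plane \<Rightarrow> point set" where
  "preimages D p = {x \<in> points D. position D x = p}"

definition crossings :: "diagram \<Rightarrow> plane set" where
  "crossings D = {p. card (preimages D p) = 2}"

definition classical :: "diagram \<Rightarrow> plane set" where
  "classical D = dom (over D)"

definition det2 :: "plane \<Rightarrow> plane \<Rightarrow> real" where
  "det2 u v = fst u * snd v - snd u * fst v"

text \<open>
  Finiteness of the set of crossings follows from the other conditions by compactness; it is
  listed for convenience.
\<close>

definition virtual_link_diagram :: "diagram \<Rightarrow> bool" where
  "virtual_link_diagram D \<longleftrightarrow>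
     components D \<ge> 1 \<and>
     (\<forall>i < components D.
        (\<forall>t. curve D i (t + 1) = curve D i t) \<and>
        curve D i C1_differentiable_on UNIV \<and>
        (\<forall>t. vector_derivative (curve D i) (at t) \<noteq> 0)) \<and>
     (\<forall>p. finite (preimages D p) \<and> card (preimages D p) \<le> 2) \<and>
     (\<forall>p. \<forall>x \<in> preimages D p. \<forall>y \<in> preimages D p.
        x \<noteq> y \<longrightarrow> det2 (velocity D x) (velocity D y) \<noteq> 0) \<and>
     finite (crossings D) \<and>
     (\<forall>p x. over D p = Some x \<longrightarrow> p \<in> crossings D \<and> x \<in> preimages D p)"

definition virtualize :: "diagram \<Rightarrow> plane \<Rightarrow> diagram" where
  "virtualize D c = D\<lparr>over := (over D)(c := None)\<rparr>"

definition other :: "diagram \<Rightarrow> point \<Rightarrow> point" where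
  "other D x = (THE y. y \<in> preimages D (position D x) \<and> y \<noteq> x)"

text \<open>
  With both strands drawn upward, the strand running from bottom-left to top-right is the one
  whose velocity comes first in the positively oriented pair of velocities.  The crossing is
  positive if this is the over-strand.
\<close>

definition crossing_sign :: "diagram \<Rightarrow> plane \<Rightarrow> int" where
  "crossing_sign D p =
     (let x = the (over D p)
      in if det2 (velocity D x) (velocity D (other D x)) > 0 then 1 else -1)"

definition writhe :: "diagram \<Rightarrow> int" where
  "writhe D = (\<Sum>p \<in> classical D. crossing_sign D p)"


section \<open>Semi-arcs and pieces of semi-arcs\<close>

text \<open>
  The points of a finite set \<open>M\<close> of marks cut the loops into pieces.  \<open>From x\<close> is the piece
  that begins at the mark \<open>x\<close>, in the direction of the orientation, and ends at the next mark
  on the same loop (which is \<open>x\<close> again if there is only one); \<open>Whole i\<close> is the \<open>i\<close>-th loop if it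
  carries no mark.  The semi-arcs are the pieces for \<open>M = passages D\<close>.
\<close>

datatype piece = From point | Whole nat

definition passages :: "diagram \<Rightarrow> point set" where
  "passages D = {x \<in> points D. position D x \<in> classical D}"

definition next_time :: "point set \<Rightarrow> point \<Rightarrow> real" where
  "next_time M x = (LEAST s. snd x < s \<and> (fst x, frac s) \<in> M)"

definition prev_time :: "point set \<Rightarrow> point \<Rightarrow> real" where
  "prev_time M x = (GREATEST s. s < snd x \<and> (fst x, frac s) \<in> M)"

definition next_mark :: "point set \<Rightarrow> point \<Rightarrow> point" where
  "next_mark M x = (fst x, frac (next_time M x))"

definition prev_mark :: "point set \<Rightarrow> point \<Rightarrow> point" where
  "prev_mark M x = (fst x, frac (prev_time M x))"

definition outgoing :: "point \<Rightarrow> piece" where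
  "outgoing x = From x"

definition incoming :: "point set \<Rightarrow> point \<Rightarrow> piece" where
  "incoming M x = From (prev_mark M x)"

definition semi_arcs :: "diagram \<Rightarrow> piece set" where
  "semi_arcs D =
     From ` passages D \<union> Whole ` {i. i < components D \<and> (\<forall>t. (i, t) \<notin> passages D)}"

fun piece_points :: "point set \<Rightarrow> piece \<Rightarrow> point set" where
  "piece_points M (From x) = (\<lambda>s. (fst x, frac s)) ` {snd x <..< next_time M x}"
| "piece_points M (Whole i) = {i} \<times> {0..<1}"


section \<open>Alexander numberings and cut systems\<close>

datatype direction = Along | Against

fun opposite :: "direction \<Rightarrow> direction" where
  "opposite Along = Against"
| "opposite Against = Along"

text \<open>
  A set of oriented cut points is a partial map: \<open>C x = Some d\<close> means that \<open>x\<close> is a cut point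
  pointing along (or against) the orientation of \<open>D\<close>.  Only the pieces for
  \<open>M = passages D \<union> dom C\<close> matter among the arguments of a numbering.
\<close>

type_synonym cuts = "point \<Rightarrow> direction option"

definition oriented_cut_points :: "diagram \<Rightarrow> cuts \<Rightarrow> bool" where
  "oriented_cut_points D C \<longleftrightarrow>
     finite (dom C) \<and> (\<forall>x \<in> dom C. x \<in> points D \<and> position D x \<notin> crossings D)"

text \<open>
  In the first condition \<open>x\<close> lies on the strand from bottom-left to top-right, so its incoming
  piece is the bottom-left and its outgoing piece the top-right one; the strand through \<open>y\<close> runs
  from bottom-right to top-left.
\<close>

definition alexander_numbering :: "diagram \<Rightarrow> cuts \<Rightarrow> (piece \<Rightarrow> int) \<Rightarrow> bool" where
  "alexander_numbering D C \<phi> \<longleftrightarrow>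
     (let M = passages D \<union> dom C in
       (\<forall>p \<in> classical D. \<forall>x \<in> preimages D p. \<forall>y \<in> preimages D p.
          x \<noteq> y \<and> det2 (velocity D x) (velocity D y) > 0 \<longrightarrow>
          (\<exists>i. \<phi> (incoming M x) = i \<and> \<phi> (outgoing y) = i \<and>
               \<phi> (incoming M y) = i + 1 \<and> \<phi> (outgoing x) = i + 1)) \<and>
       (\<forall>x. C x = Some Along \<longrightarrow> \<phi> (outgoing x) = \<phi> (incoming M x) + 1) \<and>
       (\<forall>x. C x = Some Against \<longrightarrow> \<phi> (incoming M x) = \<phi> (outgoing x) + 1))"

definition almost_classical :: "diagram \<Rightarrow> bool" where
  "almost_classical D \<longleftrightarrow> (\<exists>\<phi>. alexander_numbering D Map.empty \<phi>)"

definition cut_system :: "diagram \<Rightarrow> cuts \<Rightarrow> bool" where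
  "cut_system D C \<longleftrightarrow> oriented_cut_points D C \<and> (\<exists>\<phi>. alexander_numbering D C \<phi>)"


section \<open>States, loops and indices\<close>

datatype splice = A_splice | B_splice

type_synonym state = "plane \<Rightarrow> splice"

definition states :: "diagram \<Rightarrow> state set" where
  "states D = (classical D \<rightarrow>\<^sub>E UNIV)"

definition natural :: "diagram \<Rightarrow> state \<Rightarrow> int" where
  "natural D \<sigma> =
     int (card {p \<in> classical D. \<sigma> p = A_splice}) - int (card {p \<in> classical D. \<sigma> p = B_splice})"

definition respects_orientation :: "diagram \<Rightarrow> state \<Rightarrow> plane \<Rightarrow> bool" where
  "respects_orientation D \<sigma> p \<longleftrightarrow>
     (if crossing_sign D p = 1 then \<sigma> p = A_splice else \<sigma> p = B_splice)"

text \<open>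
  A loop of a state is traversed through directed semi-arcs.  The orientation-respecting smoothing
  joins the incoming end of each strand to the outgoing end of the other strand; the other
  smoothing joins the two incoming ends and the two outgoing ends, so that the direction of travel
  relative to the orientation of \<open>D\<close> is reversed.
\<close>

fun travel :: "diagram \<Rightarrow> state \<Rightarrow> piece \<times> direction \<Rightarrow> piece \<times> direction" where
  "travel D \<sigma> (Whole i, d) = (Whole i, d)"
| "travel D \<sigma> (From x, Along) =
     (let y = next_mark (passages D) x in
        if respects_orientation D \<sigma> (position D y)
        then (outgoing (other D y), Along)
        else (incoming (passages D) (other D y), Against))"
| "travel D \<sigma> (From x, Against) =
     (if respects_orientation D \<sigma> (position D x)
      then (incoming (passages D) (other D x), Against)
      else (outgoing (other D x), Along))"

definition traversals :: "diagram \<Rightarrow> state \<Rightarrow> (piece \<times> direction) set set" where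
  "traversals D \<sigma> = orbit (travel D \<sigma>) ` (semi_arcs D \<times> UNIV)"

text \<open>
  Every loop has two traversals, one for each direction, with the same underlying semi-arcs.
\<close>

definition loops :: "diagram \<Rightarrow> state \<Rightarrow> piece set set" where
  "loops D \<sigma> = (\<lambda>T. fst ` T) ` traversals D \<sigma>"

definition cuts_on :: "diagram \<Rightarrow> cuts \<Rightarrow> piece \<Rightarrow> direction \<Rightarrow> nat" where
  "cuts_on D C a d = card {x \<in> piece_points (passages D) a. C x = Some d}"

text \<open>
  Half the absolute value of the number of cut points in the direction of travel minus the number
  of cut points in the opposite direction; it is the same for both traversals of a loop.
\<close>

definition index :: "diagram \<Rightarrow> cuts \<Rightarrow> (piece \<times> direction) set \<Rightarrow> nat" where
  "index D C T =
     nat \<bar>\<Sum>(a, d) \<in> T. int (cuts_on D C a d) - int (cuts_on D C a (opposite d))\<bar> div 2"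

definition loops_of_index :: "diagram \<Rightarrow> cuts \<Rightarrow> state \<Rightarrow> nat \<Rightarrow> piece set set" where
  "loops_of_index D C \<sigma> i = (\<lambda>T. fst ` T) ` {T \<in> traversals D \<sigma>. index D C T = i}"

definition sharp :: "diagram \<Rightarrow> state \<Rightarrow> nat" where
  "sharp D \<sigma> = card (loops D \<sigma>)"

definition tau :: "diagram \<Rightarrow> cuts \<Rightarrow> nat \<Rightarrow> state \<Rightarrow> nat" where
  "tau D C i \<sigma> = card (loops_of_index D C \<sigma> i)"


section \<open>The multivariable polynomial\<close>

text \<open>
  The ring of Laurent polynomials in \<open>A\<close> and polynomials in \<open>d\<^sub>1, d\<^sub>2, \<dots>\<close> over the integers is the
  monoid ring of the monomials \<open>(k, m)\<close>, standing for \<open>A\<^sup>k\<close> times the product of the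
  \<open>d\<^sub>i\<close> to the power \<open>m i\<close>.  The indeterminate of index 0 never occurs below.
\<close>

type_synonym mpoly = "(int \<times> (nat \<Rightarrow>\<^sub>0 nat)) \<Rightarrow>\<^sub>0 int"

definition A_pow :: "int \<Rightarrow> mpoly" where
  "A_pow k = Poly_Mapping.single (k, 0) 1"

definition d_var :: "nat \<Rightarrow> mpoly" where
  "d_var i = Poly_Mapping.single (0, Poly_Mapping.single i 1) 1"

definition double_bracket :: "diagram \<Rightarrow> cuts \<Rightarrow> mpoly" where
  "double_bracket D C =
     (\<Sum>\<sigma> \<in> states D. A_pow (natural D \<sigma>) * (- A_pow 2 - A_pow (-2)) ^ (sharp D \<sigma> - 1) *
        (\<Prod>i \<in> {i. i \<ge> 1 \<and> tau D C i \<sigma> \<noteq> 0}. d_var i ^ tau D C i \<sigma>))"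

text \<open>The power of \<open>-A\<^sup>3\<close> with an integer exponent; its inverse is \<open>-A\<^sup>-\<^sup>3\<close>.\<close>

definition minus_A3_pow :: "int \<Rightarrow> mpoly" where
  "minus_A3_pow k = (if k \<ge> 0 then (- A_pow 3) ^ nat k else (- A_pow (-3)) ^ nat (- k))"

definition X_poly :: "diagram \<Rightarrow> cuts \<Rightarrow> mpoly" where
  "X_poly D C = minus_A3_pow (- writhe D) * double_bracket D C"

definition Exp :: "mpoly \<Rightarrow> int set" where
  "Exp g = {k. Poly_Mapping.lookup g (k, 0) \<noteq> 0}"

definition Exp_with :: "mpoly \<Rightarrow> nat \<Rightarrow> int set" where
  "Exp_with g i =
     {k. \<exists>m. Poly_Mapping.lookup g (k, m) \<noteq> 0 \<and> Poly_Mapping.lookup m i \<noteq> 0}"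

end

theory Submission
  imports Defs
begin

text \<open>
  All monomials contributed by a state \<open>\<sigma>\<close> have the same \<open>A\<close>-exponent modulo 4. If \<open>\<sigma>\<close> has \<open>s\<close> loops
  and \<open>q\<close> smoothings that do not respect the orientation, and if \<open>D\<close> has \<open>N\<close> classical crossings,
  this exponent is \<open>2 (s + q + N - 1)\<close>.

  For an almost classical diagram, directing each semi-arc along or against its orientation
  according to the parity of its number makes every state loop coherently directed. Hence loops are
  the orbits of a permutation of the semi-arcs, each change of a smoothing is a composition with a
  transposition, and \<open>s + q + N\<close> has the parity of the number \<open>n\<close> of components.

  After virtualizing a crossing, its two strands carry cut points, one along and one against the
  orientation. In every state both lie on the same loop, which has index 1 if it runs through
  one strand forwards and through the other one backwards, and index 0 otherwise.
  Replacing the virtual crossing by the orientation-respecting smoothing makes the numbering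
  consistent again; it preserves \<open>s\<close> in the first case and increases it by 1 in the second, while it
  always changes \<open>n\<close> by 1. So \<open>s + q + N + n\<close> is odd exactly if \<open>d\<^sub>1\<close> occurs in the term of \<open>\<sigma>\<close>.
\<close>

section \<open>Counting the orbits of a permutation\<close>

lemma orbit_mem_eq:
  assumes "permutation p" "y \<in> orbit p x"
  shows "orbit p y = orbit p x"
  using assms cyclic_on_orbit' orbit_cyclic_eq3 by metis

lemma orbit_subset_closed:
  assumes "x \<in> S" "\<And>y. y \<in> S \<Longrightarrow> p y \<in> S"
  shows "orbit p x \<subseteq> S"
proof
  fix y assume "y \<in> orbit p x"
  then show "y \<in> S" by induct (auto simp: assms)
qed

lemma orbit_eq_iff:
  assumes "permutation p"
  shows "orbit p x = orbit p y \<longleftrightarrow> x \<in> orbit p y"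
  using assms orbit_mem_eq permutation_self_in_orbit by metis

lemma inv_in_orbit:
  assumes "permutation p"
  shows "inv p x \<in> orbit p x"
  using orbit.base[of "inv p" x] orbit_inv_eq[OF assms] by simp

definition num_orbits :: "('a \<Rightarrow> 'a) \<Rightarrow> 'a set \<Rightarrow> nat" where
  "num_orbits p S = card (orbit p ` S)"

lemma num_orbits_cong:
  assumes "\<And>x. x \<in> S \<Longrightarrow> p x = q x" "\<And>x. x \<in> S \<Longrightarrow> p x \<in> S"
  shows "num_orbits p S = num_orbits q S"
proof -
  have "orbit p x = orbit q x" if "x \<in> S" for x
    by (rule orbit_cong0[OF that]) (use assms in auto)
  then show ?thesis unfolding num_orbits_def by (metis image_cong)
qed

lemma num_orbits_image:
  assumes "inj_on f S" "\<And>x. x \<in> S \<Longrightarrow> q (f x) = f (p x)" "\<And>x. x \<in> S \<Longrightarrow> p x \<in> S"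
    and "permutation p"
  shows "num_orbits q (f ` S) = num_orbits p S"
proof -
  have sub: "orbit p x \<subseteq> S" if "x \<in> S" for x
    using orbit_subset_closed[OF that] assms(3) by blast
  have "orbit q (f x) = f ` orbit p x" if "x \<in> S" for x
    by (rule orbit_inverse[symmetric])
      (use sub[OF that] assms permutation_self_in_orbit in auto)
  then have "orbit q ` f ` S = image f ` orbit p ` S" by (simp add: image_image)
  moreover have "inj_on (image f) (orbit p ` S)"
    by (rule inj_onI) (metis imageE sub inj_on_image_eq_iff[OF assms(1)])
  ultimately show ?thesis unfolding num_orbits_def by (simp add: card_image)
qed

section \<open>How a transposition splits or merges cycles\<close>

lemma permutation_transpose: "permutation (Transposition.transpose a b)"
  by (rule permutation_swap_id)

lemma permutation_comp_transpose:
  "permutation p \<Longrightarrow> permutation (p \<circ> Transposition.transpose a b)"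
  by (intro permutation_compose permutation_transpose)

lemma orbit_comp_transpose_other:
  assumes "permutation p" "a \<notin> orbit p x" "b \<notin> orbit p x"
  shows "orbit (p \<circ> Transposition.transpose a b) x = orbit p x"
  using assms by (intro orbit_cong permutation_self_in_orbit) (auto simp: Transposition.transpose_def)

text \<open>After \<open>a\<close> the new permutation continues as \<open>p\<close> does after
  \<open>b\<close>, and conversely; nothing else changes. So both cycles are cut open and joined
  into one.\<close>

lemma orbit_comp_transpose_merge:
  assumes p: "permutation p" and ab: "b \<notin> orbit p a"
  shows "orbit (p \<circ> Transposition.transpose a b) a = orbit p a \<union> orbit p b"
proof -
  define q where "q = p \<circ> Transposition.transpose a b"
  have q: "permutation q" unfolding q_def by (rule permutation_comp_transpose[OF p])
  have ba: "a \<notin> orbit p b" using ab p orbit_eq_iff permutation_self_in_orbit by metis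
  have qa: "q a = p b" and qb: "q b = p a" by (auto simp: q_def)
  have qo: "q y = p y" if "y \<noteq> a" "y \<noteq> b" for y using that by (simp add: q_def)
  \<comment> \<open>The new path from \<open>a\<close> enters the cycle of \<open>b\<close> at
    \<open>p b\<close> and agrees with \<open>p\<close> until it reaches \<open>b\<close>.\<close>
  have "y \<in> orbit q a" if "y \<in> orbit p b" for y using that
  proof induct
    case base then show ?case using orbit.base[of q a] qa by simp
  next
    case (step y)
    show ?case
    proof (cases "y = b")
      case True then show ?thesis using orbit.base[of q a] qa by simp
    next
      case False
      moreover have "y \<noteq> a" using step(1) ba by auto
      ultimately have "p y = q y" using qo by simp
      then show ?thesis using orbit.step[OF step(2)] by simp
    qed
  qed
  then have 1: "orbit p b \<subseteq> orbit q a" by blast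
  have "y \<in> orbit q b" if "y \<in> orbit p a" for y using that
  proof induct
    case base then show ?case using orbit.base[of q b] qb by simp
  next
    case (step y)
    show ?case
    proof (cases "y = a")
      case True then show ?thesis using orbit.base[of q b] qb by simp
    next
      case False
      moreover have "y \<noteq> b" using step(1) ab by auto
      ultimately have "p y = q y" using qo by simp
      then show ?thesis using orbit.step[OF step(2)] by simp
    qed
  qed
  then have 2: "orbit p a \<subseteq> orbit q b" by blast
  have "b \<in> orbit q a" using 1 permutation_self_in_orbit[OF p] by blast
  then have 3: "orbit q b = orbit q a" by (rule orbit_mem_eq[OF q])
  have "q y \<in> orbit p a \<union> orbit p b" if "y \<in> orbit p a \<union> orbit p b" for y
    using that qa qb qo[of y] orbit.intros[where f = p] by (metis Un_iff)
  then have "orbit q a \<subseteq> orbit p a \<union> orbit p b"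
    by (intro orbit_subset_closed) (auto simp: permutation_self_in_orbit[OF p])
  then show ?thesis using 1 2 3 unfolding q_def by blast
qed

text \<open>From \<open>b\<close> the new permutation jumps to \<open>p a\<close> and then follows
  \<open>p\<close> back to \<open>b\<close>; this closed path \<open>B\<close> never meets
  \<open>a\<close>.\<close>

lemma orbit_comp_transpose_split:
  assumes p: "permutation p" and ab: "a \<noteq> b" and orb: "b \<in> orbit p a"
  shows "b \<notin> orbit (p \<circ> Transposition.transpose a b) a"
proof -
  define q where "q = p \<circ> Transposition.transpose a b"
  have q: "permutation q" unfolding q_def by (rule permutation_comp_transpose[OF p])
  define k where "k = (LEAST n. (p ^^ n) a = b)"
  have ex: "\<exists>n. (p ^^ n) a = b" using orb unfolding orbit_altdef by auto
  have k: "(p ^^ k) a = b" unfolding k_def by (rule LeastI_ex[OF ex])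
  have kmin: "(p ^^ n) a \<noteq> b" if "n < k" for n using that not_less_Least unfolding k_def by blast
  have k0: "k > 0" using k ab by (cases k) auto
  define B where "B = (\<lambda>i. (p ^^ i) a) ` {1..k}"
  \<comment> \<open>If \<open>a\<close> came back after \<open>i\<close> steps, \<open>b\<close>
    would already have been reached after \<open>k - i\<close> steps, against the choice of
    \<open>k\<close>.\<close>
  have aB: "a \<notin> B"
  proof
    assume "a \<in> B"
    then obtain i where i: "1 \<le> i" "i \<le> k" "(p ^^ i) a = a" by (auto simp: B_def)
    have "(p ^^ (k - i)) a = (p ^^ (k - i)) ((p ^^ i) a)" using i by simp
    also have "\<dots> = (p ^^ (k - i + i)) a" by (simp only: funpow_add o_apply)
    also have "\<dots> = b" using i k by simp
    finally show False using kmin[of "k - i"] i k0 by simp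
  qed
  have bB: "b \<in> B" using k k0 by (force simp: B_def)
  have "q y \<in> B" if yB: "y \<in> B" for y
  proof (cases "y = b")
    case True
    then have "q y = (p ^^ 1) a" by (simp add: q_def)
    then show ?thesis using k0 unfolding B_def by (intro image_eqI[of _ _ 1]) auto
  next
    case False
    obtain i where i: "1 \<le> i" "i \<le> k" "y = (p ^^ i) a" using yB by (auto simp: B_def)
    have "i \<noteq> k" using False i k by auto
    have "y \<noteq> a" using yB aB by auto
    then have "q y = (p ^^ Suc i) a" using False i by (simp add: q_def)
    then show ?thesis using i \<open>i \<noteq> k\<close> unfolding B_def by (intro image_eqI[of _ _ "Suc i"]) auto
  qed
  then have "orbit q b \<subseteq> B" by (rule orbit_subset_closed[OF bB])
  then have "a \<notin> orbit q b" using aB by blast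
  then show ?thesis using orbit_eq_iff[OF q] permutation_self_in_orbit[OF q] unfolding q_def by metis
qed

text \<open>Only the orbits of \<open>a\<close> and \<open>b\<close> are affected. \<open>R\<close>
  collects the remaining ones, which are orbits of both permutations.\<close>

lemma num_orbits_merge:
  assumes p: "permutation p" and S: "finite S" "\<And>x. x \<in> S \<Longrightarrow> p x \<in> S" "a \<in> S" "b \<in> S"
    and ab: "b \<notin> orbit p a"
  shows "num_orbits p S = num_orbits (p \<circ> Transposition.transpose a b) S + 1"
proof -
  define q where "q = p \<circ> Transposition.transpose a b"
  have q: "permutation q" unfolding q_def by (rule permutation_comp_transpose[OF p])
  define R where "R = orbit p ` {x \<in> S. x \<notin> orbit p a \<and> x \<notin> orbit p b}"
  have ne: "orbit p a \<noteq> orbit p b" using ab permutation_self_in_orbit[OF p] by metis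
  have P: "orbit p ` S = insert (orbit p a) (insert (orbit p b) R)"
  proof -
    have "orbit p x \<in> insert (orbit p a) (insert (orbit p b) R)" if "x \<in> S" for x
      using that orbit_mem_eq[OF p, of x a] orbit_mem_eq[OF p, of x b] unfolding R_def by blast
    then show ?thesis using S unfolding R_def by blast
  qed
  have nR: "orbit p a \<notin> R" "orbit p b \<notin> R"
    unfolding R_def using orbit_eq_iff[OF p] permutation_self_in_orbit[OF p] by blast+
  have oab: "orbit q a = orbit p a \<union> orbit p b"
    unfolding q_def by (rule orbit_comp_transpose_merge[OF p ab])
  have oR: "orbit q x = orbit p x" if "x \<notin> orbit p a" "x \<notin> orbit p b" for x
    unfolding q_def by (rule orbit_comp_transpose_other[OF p])
      (use that orbit_eq_iff[OF p] permutation_self_in_orbit[OF p] in metis)+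
  have Q: "orbit q ` S = insert (orbit p a \<union> orbit p b) R"
  proof -
    have "orbit q x \<in> insert (orbit p a \<union> orbit p b) R" if "x \<in> S" for x
    proof (cases "x \<in> orbit p a \<or> x \<in> orbit p b")
      case True
      then have "x \<in> orbit q a" using oab by blast
      then show ?thesis using orbit_mem_eq[OF q] oab by auto
    next
      case False
      then show ?thesis using oR[of x] that unfolding R_def by blast
    qed
    moreover have "orbit p x \<in> orbit q ` S" if "x \<in> S" "x \<notin> orbit p a" "x \<notin> orbit p b" for x
      using that oR by blast
    moreover have "orbit p a \<union> orbit p b \<in> orbit q ` S" using S oab by (metis imageI)
    ultimately show ?thesis unfolding R_def by blast
  qed
  have "orbit p a \<union> orbit p b \<notin> R"
  proof
    assume "orbit p a \<union> orbit p b \<in> R"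
    then obtain x where "x \<notin> orbit p a" "x \<notin> orbit p b" "orbit p a \<union> orbit p b = orbit p x"
      unfolding R_def by blast
    then show False using permutation_self_in_orbit[OF p, of x] by blast
  qed
  then show ?thesis
    using P Q nR ne S unfolding num_orbits_def q_def[symmetric] by (simp add: R_def)
qed

text \<open>A transposition is its own inverse, so this is merging applied to the composite, in
  which \<open>a\<close> and \<open>b\<close> lie on different cycles.\<close>

lemma num_orbits_split:
  assumes p: "permutation p" and S: "finite S" "\<And>x. x \<in> S \<Longrightarrow> p x \<in> S" "a \<in> S" "b \<in> S"
    and ab: "a \<noteq> b" "b \<in> orbit p a"
  shows "num_orbits (p \<circ> Transposition.transpose a b) S = num_orbits p S + 1"
proof -
  have "(p \<circ> Transposition.transpose a b) x \<in> S" if "x \<in> S" for x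
    using that S by (simp add: Transposition.transpose_def)
  from num_orbits_merge[OF permutation_comp_transpose[OF p] S(1) this S(3,4)
      orbit_comp_transpose_split[OF p ab]]
  show ?thesis by (simp add: comp_assoc)
qed

lemma inv_in_closed:
  assumes "permutation p" "\<And>x. x \<in> S \<Longrightarrow> p x \<in> S" "x \<in> S"
  shows "inv p x \<in> S"
  using inv_in_orbit[OF assms(1), of x] orbit_subset_closed[of x S p] assms by blast

text \<open>A transposition after \<open>p\<close> equals the transposition of the preimages before
  \<open>p\<close>.\<close>

lemma num_orbits_transpose_left_split:
  assumes p: "permutation p" and S: "finite S" "\<And>x. x \<in> S \<Longrightarrow> p x \<in> S" "a \<in> S" "b \<in> S"
    and ab: "a \<noteq> b" "b \<in> orbit p a"
  shows "num_orbits (Transposition.transpose a b \<circ> p) S = num_orbits p S + 1"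
proof -
  have bij: "bij p" by (rule permutation_bijective[OF p])
  have "inv p b \<in> orbit p (inv p a)"
    using orbit_eq_iff[OF p] inv_in_orbit[OF p] ab(2) by metis
  moreover have "inv p a \<noteq> inv p b" using bij ab(1) by (metis bij_inv_eq_iff)
  ultimately show ?thesis unfolding transpose_comp_eq[OF bij]
    using inv_in_closed[OF p S(2)] S by (intro num_orbits_split[OF p S(1,2)]) auto
qed

lemma num_orbits_transpose_left_parity:
  assumes p: "permutation p" and S: "finite S" "\<And>x. x \<in> S \<Longrightarrow> p x \<in> S" "a \<in> S" "b \<in> S"
    and ab: "a \<noteq> b"
  shows "odd (num_orbits (Transposition.transpose a b \<circ> p) S + num_orbits p S)"
proof -
  have bij: "bij p" by (rule permutation_bijective[OF p])
  have i: "inv p a \<in> S" "inv p b \<in> S" using inv_in_closed[OF p S(2)] S by auto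
  have ne: "inv p a \<noteq> inv p b" using bij ab(1) by (metis bij_inv_eq_iff)
  show ?thesis unfolding transpose_comp_eq[OF bij]
    using num_orbits_split[OF p S(1,2) i ne] num_orbits_merge[OF p S(1,2) i]
    by (cases "inv p b \<in> orbit p (inv p a)") auto
qed

text \<open>The involution is a product of \<open>k\<close> disjoint transpositions, each of which
  changes the number of orbits by 1, up or down.\<close>

lemma num_orbits_involution_parity:
  assumes "permutation p" "finite S" "\<And>x. x \<in> S \<Longrightarrow> p x \<in> S"
    and "\<And>x. f (f x) = x" "\<And>x. x \<in> S \<Longrightarrow> f x \<in> S" "\<And>x. x \<notin> S \<Longrightarrow> f x = x"
    and "card {x \<in> S. f x \<noteq> x} = 2 * k"
  shows "even (num_orbits (f \<circ> p) S + num_orbits p S + k)"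
  using assms(4-7)
proof (induction k arbitrary: f)
  case 0
  then have "{x \<in> S. f x \<noteq> x} = {}" using assms(2) by simp
  then have "f = id" using 0 by (auto simp: fun_eq_iff)
  then show ?case by simp
next
  case (Suc k)
  let ?M = "{x \<in> S. f x \<noteq> x}"
  have "?M \<noteq> {}" using Suc.prems(4) by (intro notI) simp
  then obtain a where a: "a \<in> S" "f a \<noteq> a" by blast
  define b where "b = f a"
  have b: "b \<in> S" "f b = a" "f a = b" "a \<noteq> b" using a Suc.prems by (auto simp: b_def)
  \<comment> \<open>Removing one transposition from \<open>f\<close> leaves an involution that moves
    two points fewer.\<close>
  define g where "g = Transposition.transpose a b \<circ> f"
  have g: "g x = (if x = a \<or> x = b then x else f x)" for x
    using b Suc.prems(1)[of x] unfolding g_def Transposition.transpose_def by auto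
  have gg: "g (g x) = x" for x using g b Suc.prems(1) by metis
  have gS: "g x \<in> S" if "x \<in> S" for x using that g Suc.prems by auto
  have gn: "g x = x" if "x \<notin> S" for x using that g Suc.prems by auto
  have "{x \<in> S. g x \<noteq> x} = ?M - {a, b}" using g by auto
  moreover have "card (?M - {a, b}) = card ?M - card {a, b}"
    using a b Suc.prems by (intro card_Diff_subset) auto
  ultimately have "card {x \<in> S. g x \<noteq> x} = 2 * k"
    using Suc.prems(4) b(4) by simp
  from Suc.IH[OF gg gS gn this]
  have IH: "even (num_orbits (g \<circ> p) S + num_orbits p S + k)" .
  have gperm: "permutation g"
    unfolding permutation_permutes
    by (intro exI[of _ S] conjI assms(2)) (auto simp: permutes_def gn; metis gg)
  have f: "f = Transposition.transpose a b \<circ> g" unfolding g_def by (simp add: fun_eq_iff)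
  have "odd (num_orbits (Transposition.transpose a b \<circ> (g \<circ> p)) S + num_orbits (g \<circ> p) S)"
    by (rule num_orbits_transpose_left_parity)
      (use gS assms b a gperm permutation_compose in auto)
  then have "odd (num_orbits (f \<circ> p) S + num_orbits (g \<circ> p) S)" 
    using arg_cong[OF f, of "\<lambda>h. num_orbits (h \<circ> p) S"] by (simp only: comp_assoc not_False_eq_True)
  then show ?case using IH unfolding o_def by auto
qed

section \<open>Orbits and their reversals\<close>

lemma orbit_reverse:
  assumes p: "permutation p" and r: "\<And>y. r (r y) = y"
    and pr: "\<And>y. y \<in> S \<Longrightarrow> p (r (p (r y))) = y" "\<And>y. y \<in> S \<Longrightarrow> p y \<in> S" "\<And>y. y \<in> S \<Longrightarrow> r y \<in> S"
    and x: "x \<in> S"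
  shows "orbit p (r x) = r ` orbit p x"
proof -
  have sub: "orbit p x \<subseteq> S" by (rule orbit_subset_closed[OF x pr(2)])
  \<comment> \<open>On \<open>S\<close> the map \<open>r\<close> conjugates \<open>p\<close> to its
    inverse, and a permutation and its inverse have the same orbits.\<close>
  have inv: "inv p y = r (p (r y))" if "y \<in> S" for y
    using pr(1)[OF that] permutation_bijective[OF p] by (metis bij_inv_eq_iff)
  have "r ` orbit (inv p) x = orbit p (r x)"
  proof (rule orbit_inverse)
    show "x \<in> orbit (inv p) x" using permutation_self_in_orbit p orbit_inv_eq by metis
    show "p (r y) = r (inv p y)" if "y \<in> orbit (inv p) x" for y
    proof -
      have "y \<in> S" using that sub orbit_inv_eq[OF p] by auto
      then show ?thesis using inv r by auto
    qed
  qed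
  then show ?thesis using orbit_inv_eq[OF p] by simp
qed

text \<open>Each orbit in \<open>X\<close> lies in \<open>E\<close> or in its complement, and
  \<open>r\<close> maps the orbits of the first kind bijectively to those of the second.\<close>

lemma num_orbits_double:
  assumes p: "permutation p" and r: "\<And>y. r (r y) = y"
    and pr: "\<And>y. y \<in> X \<Longrightarrow> p (r (p (r y))) = y" "\<And>y. y \<in> X \<Longrightarrow> p y \<in> X" "\<And>y. y \<in> X \<Longrightarrow> r y \<in> X"
    and E: "E \<subseteq> X" "\<And>y. y \<in> E \<Longrightarrow> p y \<in> E" "\<And>y. y \<in> X \<Longrightarrow> r y \<in> E \<longleftrightarrow> y \<notin> E"
    and fin: "finite X"
  shows "num_orbits p X = 2 * num_orbits p E"
proof -
  have oE: "orbit p x \<subseteq> E" if "x \<in> E" for x by (rule orbit_subset_closed[OF that E(2)])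
  have orev: "orbit p (r x) = r ` orbit p x" if "x \<in> X" for x
    by (rule orbit_reverse[OF p r pr that])
  have X: "X = E \<union> r ` E" using E r pr(3) by (auto simp: image_iff) metis+
  have "orbit p ` X = orbit p ` E \<union> image r ` orbit p ` E"
  proof -
    have "orbit p ` r ` E = image r ` orbit p ` E"
      unfolding image_image using orev E(1) by (intro image_cong) auto
    then show ?thesis unfolding X image_Un by simp
  qed
  moreover have "orbit p ` E \<inter> image r ` orbit p ` E = {}"
  proof -
    have False if "x \<in> E" "y \<in> E" "orbit p x = r ` orbit p y" for x y
    proof -
      have "r y \<in> orbit p x" using that(3) permutation_self_in_orbit[OF p] by auto
      then have "r y \<in> E" using oE that by blast
      then show False using E that by blast
    qed
    then show ?thesis by blast
  qed
  moreover have "card (image r ` orbit p ` E) = card (orbit p ` E)"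
    by (rule card_image) (metis inj_on_def r inj_image_eq_iff)
  moreover have "finite (orbit p ` E)" using finite_subset[OF E(1) fin] by simp
  ultimately show ?thesis unfolding num_orbits_def by (simp add: card_Un_disjoint)
qed

text \<open>An orbit of the product of two fixed-point free involutions cannot meet its own reversal:
  halfway between a point and its reversal, one of the involutions would have a fixed point.\<close>

lemma reverse_notin_orbit:
  assumes p: "permutation p"
    and pr: "\<And>y. y \<in> X \<Longrightarrow> p (r (p (r y))) = y" "\<And>y. y \<in> X \<Longrightarrow> p y \<in> X" "\<And>y. y \<in> X \<Longrightarrow> r y \<in> X"
    and r: "\<And>y. r (r y) = y" "\<And>y. r y \<noteq> y"
    and fix_free: "\<And>y. y \<in> X \<Longrightarrow> p y \<noteq> r y"
    and x: "x \<in> X"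
  shows "r x \<notin> orbit p x"
proof -
  have "(p ^^ n) x \<noteq> r x" if "x \<in> X" for n x
    using that
  proof (induction n arbitrary: x rule: less_induct)
    case (less n)
    consider "n = 0" | "n = 1" | m where "n = Suc (Suc m)"
      by (metis One_nat_def old.nat.exhaust)
    then show ?case
    proof cases
      case 1 then show ?thesis using r(2)[of x] by simp
    next
      case 2 then show ?thesis using fix_free less.prems by simp
    next
      case 3
      show ?thesis
      proof
        assume "(p ^^ n) x = r x"
        \<comment> \<open>Dropping the first and the last step gives a path of \<open>n - 2\<close>
          steps from \<open>p x\<close> to its own reversal.\<close>
        then have "p ((p ^^ m) (p x)) = r x" using 3 by (simp add: funpow_swap1)
        moreover have "p (r (p x)) = r x" using pr(1)[of "r x"] pr(3) r less.prems by simp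
        ultimately have "(p ^^ m) (p x) = r (p x)"
          using permutation_bijective[OF p] by (metis bij_inv_eq_iff)
        then show False using less.IH[of m "p x"] pr(2) less.prems 3 by simp
      qed
    qed
  qed
  note * = this[OF x]
  show ?thesis unfolding orbit_altdef using * by (auto dest: sym)
qed

section \<open>Combinatorial link diagrams and their states\<close>

lemma sum_orbit_shift:
  fixes g :: "'a \<Rightarrow> int"
  assumes p: "permutation p"
  shows "(\<Sum>y\<in>orbit p x. g (p y)) = (\<Sum>y\<in>orbit p x. g y)"
proof -
  have fin: "finite (orbit p x)" by (rule finite_orbit[OF permutation_self_in_orbit[OF p]])
  have inj: "inj_on p (orbit p x)"
    using permutation_bijective[OF p] bij_is_inj inj_on_subset by blast
  have "p ` orbit p x = orbit p x"
    by (rule endo_inj_surj[OF fin _ inj]) (auto intro: orbit.step)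
  then have "bij_betw p (orbit p x) (orbit p x)" using inj by (simp add: bij_betw_def)
  then show ?thesis by (rule sum.reindex_bij_betw)
qed

fun rev_arc :: "'a \<times> direction \<Rightarrow> 'a \<times> direction" where
  "rev_arc (x, d) = (x, opposite d)"

text \<open>Travel against the orientation meets the cut points of an arc in the opposite sense,
  hence the sign.\<close>

fun weight :: "('a \<Rightarrow> int) \<Rightarrow> 'a \<times> direction \<Rightarrow> int" where
  "weight \<delta> (x, Along) = \<delta> x"
| "weight \<delta> (x, Against) = - \<delta> x"

lemma opposite_opposite [simp]: "opposite (opposite d) = d" by (cases d) auto
lemma opposite_neq [simp]: "opposite d \<noteq> d" "d \<noteq> opposite d" by (cases d; simp)+
lemma rev_arc_rev_arc [simp]: "rev_arc (rev_arc e) = e" by (cases e) auto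
lemma rev_arc_neq [simp]: "rev_arc e \<noteq> e" by (cases e) auto
lemma fst_rev_arc [simp]: "fst (rev_arc e) = fst e" by (cases e) auto
lemma rev_arc_unique: "fst e = fst e' \<Longrightarrow> e' = e \<or> e' = rev_arc e"
  by (cases e; cases e'; cases "snd e"; cases "snd e'") auto
lemma UNIV_direction: "UNIV = {Along, Against}"
  using direction.exhaust by auto
lemma finite_direction [simp]: "finite (UNIV :: direction set)"
  by (simp add: UNIV_direction)

text \<open>The arc \<open>x\<close> runs from the mark \<open>x\<close> to the mark \<open>nx x\<close>, and \<open>ot\<close> exchanges the two marks
  of a crossing; a closed arc without marks is a common fixed point of \<open>nx\<close> and \<open>ot\<close>.
  The marks in \<open>U\<close> are those at the crossings whose smoothing does not respect the orientation.\<close>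

locale arc_system =
  fixes A :: "'a set" and nx ot :: "'a \<Rightarrow> 'a" and U :: "'a set"
  assumes fin: "finite A" and nx: "nx permutes A" and ot: "ot permutes A"
    and ot_ot [simp]: "ot (ot x) = x"
    and U_sub: "U \<subseteq> A" and ot_U: "x \<in> U \<Longrightarrow> ot x \<in> U" and ot_neq: "x \<in> U \<Longrightarrow> ot x \<noteq> x"
begin

text \<open>Travel along the arc \<open>x\<close> arrives at the mark \<open>nx x\<close>, travel
  against it at the mark \<open>x\<close>. At a mark in \<open>U\<close> the direction
  turns.\<close>

definition step :: "'a \<times> direction \<Rightarrow> 'a \<times> direction" where
  "step e = (case e of
     (x, Along) \<Rightarrow> if nx x \<in> U then (inv nx (ot (nx x)), Against) else (ot (nx x), Along)
   | (x, Against) \<Rightarrow> if x \<in> U then (ot x, Along) else (inv nx (ot x), Against))"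

lemma step_simps [simp]:
  "step (x, Along) = (if nx x \<in> U then (inv nx (ot (nx x)), Against) else (ot (nx x), Along))"
  "step (x, Against) = (if x \<in> U then (ot x, Along) else (inv nx (ot x), Against))"
  by (simp_all add: step_def)

abbreviation X :: "('a \<times> direction) set" where "X \<equiv> A \<times> UNIV"

lemma ot_U_iff [simp]: "ot x \<in> U \<longleftrightarrow> x \<in> U"
  using ot_U ot_ot by metis

lemma nx_inv [simp]: "nx (inv nx x) = x" "inv nx (nx x) = x"
  using permutes_inverses[OF nx] by auto

lemma in_A [simp]: "nx x \<in> A \<longleftrightarrow> x \<in> A" "inv nx x \<in> A \<longleftrightarrow> x \<in> A" "ot x \<in> A \<longleftrightarrow> x \<in> A"
  using permutes_in_image[OF nx] permutes_in_image[OF permutes_inv[OF nx]]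
    permutes_in_image[OF ot] by auto

lemma finite_X: "finite X" using fin by simp

text \<open>A smoothing joins ends of arcs in pairs, so each junction can be passed both ways. This
  makes the step invertible.\<close>

lemma step_rev: "step (rev_arc (step (rev_arc e))) = e"
  by (cases e; cases "snd e") auto

lemma step_in [simp]: "step e \<in> X \<longleftrightarrow> e \<in> X"
  by (cases e; cases "snd e") auto

lemma rev_in [simp]: "rev_arc e \<in> X \<longleftrightarrow> e \<in> X"
  by (cases e) auto

lemma step_outside: "e \<notin> X \<Longrightarrow> step e = e"
proof -
  assume "e \<notin> X"
  then obtain x d where e: "e = (x, d)" "x \<notin> A" by (cases e) auto
  have "nx x = x" "ot x = x" "x \<notin> U"
    using e permutes_not_in[OF nx] permutes_not_in[OF ot] U_sub by auto
  moreover from this have "inv nx x = x" by (metis nx_inv(2))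
  ultimately show ?thesis using e by (cases d) auto
qed

lemma permutation_step: "permutation step"
proof -
  have "bij step"
    by (rule o_bij[of "\<lambda>e. rev_arc (step (rev_arc e))"])
      (simp_all add: fun_eq_iff step_rev, metis step_rev rev_arc_rev_arc)
  then have "step permutes X"
    by (simp add: permutes_def step_outside bij_iff)
  then show ?thesis using finite_X permutation_permutes by blast
qed

text \<open>Turning straight back on an arc would require a mark in \<open>U\<close> that is fixed
  by \<open>ot\<close>.\<close>

lemma step_neq_rev: "step e \<noteq> rev_arc e"
proof (cases e)
  case (Pair x d)
  then show ?thesis using ot_neq by (cases d) (auto, metis nx_inv(1))
qed

lemma rev_notin_orbit: "e \<in> X \<Longrightarrow> rev_arc e \<notin> orbit step e"
  by (rule reverse_notin_orbit[OF permutation_step, of X])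
    (simp_all add: step_rev step_neq_rev del: step_simps)

lemma orbit_rev: "e \<in> X \<Longrightarrow> orbit step (rev_arc e) = rev_arc ` orbit step e"
  by (rule orbit_reverse[OF permutation_step, of _ X]) (simp_all add: step_rev)

lemma orbit_sub: "e \<in> X \<Longrightarrow> orbit step e \<subseteq> X"
  by (rule orbit_subset_closed) simp_all

section \<open>Loops as pairs of opposite orbits\<close>

definition state_loops :: "'a set set" where
  "state_loops = (\<lambda>T. fst ` T) ` orbit step ` X"

text \<open>Forgetting directions identifies an orbit exactly with its reversal, and the two differ
  by \<open>rev_notin_orbit\<close>.\<close>

lemma num_orbits_step: "num_orbits step X = 2 * card state_loops"
proof -
  let ?O = "orbit step ` X"
  let ?g = "\<lambda>T :: ('a \<times> direction) set. fst ` T"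
  have two: "card {T \<in> ?O. ?g T = L} = 2" if L: "L \<in> ?g ` ?O" for L
  proof -
    obtain e where e: "e \<in> X" "L = ?g (orbit step e)" using L by auto
    have "{T \<in> ?O. ?g T = L} = {orbit step e, orbit step (rev_arc e)}"
    proof (intro equalityI subsetI)
      fix T assume "T \<in> {T \<in> ?O. ?g T = L}"
      then obtain e' where e': "e' \<in> X" "T = orbit step e'" "?g T = L" by auto
      have "fst e' \<in> L" using e' permutation_self_in_orbit[OF permutation_step, of e'] by auto
      then obtain f where f: "f \<in> orbit step e" "fst f = fst e'" using e(2) by auto
      have fX: "f \<in> X" using f orbit_sub[OF e(1)] by auto
      have of: "orbit step f = orbit step e" by (rule orbit_mem_eq[OF permutation_step f(1)])
      from rev_arc_unique[OF f(2)] show "T \<in> {orbit step e, orbit step (rev_arc e)}"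
      proof
        assume "e' = rev_arc f"
        then have "T = rev_arc ` orbit step e" using e' orbit_rev[OF fX] of by simp
        then show ?thesis using orbit_rev[OF e(1)] by simp
      qed (use e' of in simp)
    next
      fix T assume "T \<in> {orbit step e, orbit step (rev_arc e)}"
      moreover have "?g (orbit step (rev_arc e)) = L"
        using orbit_rev[OF e(1)] e(2) by (simp add: image_image)
      moreover have "orbit step (rev_arc e) \<in> ?O" using e(1) by (intro imageI) simp
      ultimately show "T \<in> {T \<in> ?O. ?g T = L}" using e by blast
    qed
    moreover have "orbit step e \<noteq> orbit step (rev_arc e)"
      using rev_notin_orbit[OF e(1)] permutation_self_in_orbit[OF permutation_step] by metis
    ultimately show ?thesis by simp
  qed
  have "card ?O = (\<Sum>L\<in>?g ` ?O. card {T \<in> ?O. ?g T = L})"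
    using sum.image_gen[of ?O "\<lambda>_. 1 :: nat" ?g] finite_X by simp
  also have "\<dots> = (\<Sum>L\<in>?g ` ?O. 2)" by (rule sum.cong[OF refl two])
  finally show ?thesis unfolding num_orbits_def state_loops_def by simp
qed

text \<open>\<open>uI\<close> and \<open>uO\<close> stand for values just before and just after a
  mark. Each travelled arc ends at the value at which the next one starts, also where the direction
  turns, so the sum telescopes around the loop.\<close>

lemma weight_sum_zero:
  assumes e: "e \<in> X"
    and u: "\<And>x. x \<in> A \<Longrightarrow> uI x = uO (ot x)" "\<And>x. x \<in> U \<Longrightarrow> uI x = uO x"
  shows "(\<Sum>f\<in>orbit step e. weight (\<lambda>x. uI (nx x) - uO x) f) = 0"
proof -
  \<comment> \<open>\<open>g f\<close> is the value where the travel through \<open>f\<close>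
    starts, so \<open>g (rev_arc f)\<close> is the value where it ends.\<close>
  define g :: "'a \<times> direction \<Rightarrow> int" where "g f = (case f of (x, Along) \<Rightarrow> uO x | (x, Against) \<Rightarrow> uI (nx x))" for f
  have gs: "g (step f) = g (rev_arc f)" if "f \<in> X" for f
  proof (cases f)
    case (Pair x d)
    then show ?thesis
      using that u(1)[of "nx x"] u(1)[of x] u(2)[of "nx x"] u(2)[of x] u(1)[of "ot x"] u(2)[of "ot x"]
        u(1)[of "ot (nx x)"] u(2)[of "ot (nx x)"]
      by (cases d) (auto simp: g_def)
  qed
  have "(\<Sum>f\<in>orbit step e. weight (\<lambda>x. uI (nx x) - uO x) f)
      = (\<Sum>f\<in>orbit step e. g (rev_arc f) - g f)"
  proof (rule sum.cong[OF refl])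
    fix f show "weight (\<lambda>x. uI (nx x) - uO x) f = g (rev_arc f) - g f"
      by (cases f; cases "snd f") (auto simp: g_def)
  qed
  also have "\<dots> = (\<Sum>f\<in>orbit step e. g (step f) - g f)"
    using gs orbit_sub[OF e] by (intro sum.cong) auto
  also have "\<dots> = 0" by (simp only: sum_subtractf sum_orbit_shift[OF permutation_step] diff_self)
  finally show ?thesis .
qed

text \<open>Modulo 2, the numbering changes at a smoothing exactly when the direction of travel does.\<close>

lemma weight_sum_even:
  assumes e: "e \<in> X"
    and v: "\<And>x. x \<in> U \<Longrightarrow> odd (v (ot x) - v x)"
  shows "even (\<Sum>f\<in>orbit step e. weight (\<lambda>x. v (ot (nx x)) - v x) f)"
proof -
  \<comment> \<open>The 1 added for backward travel offsets the odd jump at a smoothing where the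
    direction turns.\<close>
  define g :: "'a \<times> direction \<Rightarrow> int" where "g f = (case f of (x, Along) \<Rightarrow> v x | (x, Against) \<Rightarrow> v (ot (nx x)) + 1)" for f
  have "even (g (step f) - (g f + weight (\<lambda>x. v (ot (nx x)) - v x) f))" for f
  proof (cases f)
    case (Pair x d)
    then show ?thesis
      using v[of "nx x"] v[of x]
      by (cases d) (auto simp: g_def)
  qed
  then have "even (\<Sum>f\<in>orbit step e. g (step f) - (g f + weight (\<lambda>x. v (ot (nx x)) - v x) f))"
    by (intro dvd_sum) blast
  then show ?thesis
    by (simp add: sum_subtractf sum.distrib sum_orbit_shift[OF permutation_step] del: step_simps)
qed

text \<open>If the numbering is consistent modulo 2, it directs every arc such that each state loop is
  traversed coherently, so loops are the orbits of a permutation of the arcs, and changing a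
  smoothing composes this permutation with a transposition.\<close>

lemma parity_consistent:
  assumes v: "\<And>x. x \<in> A \<Longrightarrow> even (v (ot (nx x)) - v x :: int)"
    and vU: "\<And>x. x \<in> U \<Longrightarrow> odd (v (ot x) - v x)"
    and N: "card {x \<in> A. ot x \<noteq> x} = 2 * N" and k: "card U = 2 * k"
  shows "even (card state_loops + num_orbits nx A + N + k)"
proof -
  \<comment> \<open>\<open>Z\<close> is the state whose smoothings all respect the
    orientation.\<close>
  interpret Z: arc_system A nx ot "{}"
    by unfold_locales (use fin nx ot in auto)
  \<comment> \<open>One direction for each arc. Steps stay inside \<open>E\<close>, since the parity
    of the number changes exactly where the direction turns.\<close>
  define E where "E = {(x, d). x \<in> A \<and> (d = Along \<longleftrightarrow> even (v x))}"
  have EX: "E \<subseteq> X" by (auto simp: E_def)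
  have finE: "finite E" using finite_subset[OF EX finite_X] .
  have Er: "rev_arc y \<in> E \<longleftrightarrow> y \<notin> E" if "y \<in> X" for y
    using that by (cases y; cases "snd y") (auto simp: E_def)
  \<comment> \<open>At a mark in \<open>U\<close> where arcs of \<open>E\<close> start,
    \<open>F\<close> exchanges the two directed arcs that start there. This turns the oriented
    smoothing into the actual one.\<close>
  define F where "F e = (if e \<in> E then case e of
      (x, Along) \<Rightarrow> if x \<in> U then (inv nx x, Against) else (x, Along)
    | (x, Against) \<Rightarrow> if nx x \<in> U then (nx x, Along) else (x, Against) else e)" for e
  have Zstep: "Z.step e \<in> E" if "e \<in> E" for e
  proof (cases e)
    case (Pair x d)
    then show ?thesis using that v[of x] v[of "inv nx (ot x)"]
      by (cases d) (auto simp: E_def)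
  qed
  have FE: "F e \<in> E" if "e \<in> E" for e
  proof (cases e)
    case (Pair x d)
    then show ?thesis using that v[of x] v[of "inv nx x"] vU[of x] vU[of "nx x"]
      by (cases d) (auto simp: E_def F_def)
  qed
  have FF: "F (F e) = e" for e
  proof (cases "e \<in> E")
    case True
    then have "F e \<in> E" by (rule FE)
    then show ?thesis using True by (cases e; cases "snd e") (auto simp: F_def)
  qed (simp add: F_def)
  have step: "step e = F (Z.step e)" if "e \<in> E" for e
  proof -
    have "Z.step e \<in> E" by (rule Zstep[OF that])
    then show ?thesis by (cases e; cases "snd e") (auto simp: F_def)
  qed
  have stepE: "step e \<in> E" if "e \<in> E" for e using step[OF that] FE Zstep that by simp
  \<comment> \<open>Of the two marks of a crossing in \<open>U\<close> exactly one has an even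
    number. Hence \<open>F\<close> consists of \<open>k\<close> transpositions.\<close>
  define Ue where "Ue = {x \<in> U. even (v x)}"
  have "finite U" using finite_subset[OF U_sub fin] .
  have "{x \<in> U. odd (v x)} = ot ` Ue"
  proof (intro equalityI subsetI)
    fix x assume "x \<in> {x \<in> U. odd (v x)}"
    then have "ot x \<in> Ue" using vU[of x] unfolding Ue_def by auto
    then show "x \<in> ot ` Ue" by (metis imageI ot_ot)
  next
    fix x assume "x \<in> ot ` Ue"
    then obtain y where "x = ot y" "y \<in> U" "even (v y)" unfolding Ue_def by auto
    then show "x \<in> {x \<in> U. odd (v x)}" using vU[of y] by auto
  qed
  moreover have "inj ot" by (metis injI ot_ot)
  ultimately have "card {x \<in> U. odd (v x)} = card Ue" by (simp add: card_image inj_on_subset)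
  moreover have "card U = card Ue + card {x \<in> U. odd (v x)}"
    unfolding Ue_def using \<open>finite U\<close>
    by (subst card_Un_disjoint[symmetric]) (auto intro: arg_cong[where f = card])
  ultimately have Ue: "card Ue = k" using k by simp
  have moved: "card {e \<in> E. F e \<noteq> e} = 2 * k"
  proof -
    have "{e \<in> E. F e \<noteq> e} = (\<lambda>x. (x, Along)) ` Ue \<union> (\<lambda>x. (inv nx x, Against)) ` Ue"
    proof (intro equalityI subsetI)
      fix e assume e: "e \<in> {e \<in> E. F e \<noteq> e}"
      obtain x d where xd: "e = (x, d)" by (cases e)
      show "e \<in> (\<lambda>x. (x, Along)) ` Ue \<union> (\<lambda>x. (inv nx x, Against)) ` Ue"
      proof (cases d)
        case Along
        then show ?thesis using e xd by (auto simp: F_def E_def Ue_def split: if_splits)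
      next
        case Against
        then have "x \<in> A" "odd (v x)" "nx x \<in> U"
          using e xd by (auto simp: F_def E_def split: if_splits)
        then have "nx x \<in> Ue" using v[of x] vU[of "nx x"] unfolding Ue_def by auto
        then have "(inv nx (nx x), Against) \<in> (\<lambda>x. (inv nx x, Against)) ` Ue" by blast
        then show ?thesis using xd Against by simp
      qed
    next
      fix e assume "e \<in> (\<lambda>x. (x, Along)) ` Ue \<union> (\<lambda>x. (inv nx x, Against)) ` Ue"
      then show "e \<in> {e \<in> E. F e \<noteq> e}"
      proof
        assume "e \<in> (\<lambda>x. (x, Along)) ` Ue"
        then show ?thesis using U_sub by (auto simp: Ue_def F_def E_def)
      next
        assume "e \<in> (\<lambda>x. (inv nx x, Against)) ` Ue"
        then obtain x where x: "e = (inv nx x, Against)" "x \<in> U" "even (v x)"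
          by (auto simp: Ue_def)
        then show ?thesis using U_sub v[of "inv nx x"] vU[of x]
          by (auto simp: F_def E_def)
      qed
    qed
    moreover have "card ((\<lambda>x. (x, Along)) ` Ue) = k" using Ue by (simp add: card_image inj_on_def)
    moreover have "card ((\<lambda>x. (inv nx x, Against)) ` Ue) = k"
      using Ue by (subst card_image) (auto simp: inj_on_def, metis nx_inv(1))
    moreover have "finite Ue" using \<open>finite U\<close> by (simp add: Ue_def)
    ultimately show ?thesis by (subst \<open>{e \<in> E. F e \<noteq> e} = _\<close>, subst card_Un_disjoint) auto
  qed
  have "even (num_orbits (F \<circ> Z.step) E + num_orbits Z.step E + k)"
    by (rule num_orbits_involution_parity[OF Z.permutation_step finE Zstep FF FE _ moved])
      (simp_all add: F_def)
  moreover have "num_orbits (F \<circ> Z.step) E = num_orbits step E"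
    by (rule num_orbits_cong[symmetric]) (simp_all add: step stepE FE Zstep del: step_simps Z.step_simps)
  moreover have "num_orbits step X = 2 * num_orbits step E"
    by (rule num_orbits_double[OF permutation_step, of rev_arc])
      (use EX Er stepE finite_X in \<open>simp_all add: step_rev del: step_simps\<close>)
  moreover have "num_orbits Z.step X = 2 * num_orbits Z.step E"
    by (rule num_orbits_double[OF Z.permutation_step, of rev_arc])
      (use EX Er Zstep finite_X in \<open>simp_all add: Z.step_rev del: Z.step_simps\<close>)
  \<comment> \<open>For the oriented state the forward arcs are another choice of directions. Either
    choice contains half of the orbits, so \<open>E\<close> may be replaced by \<open>A\<close> with
    the permutation \<open>ot \<circ> nx\<close>.\<close>
  moreover have "num_orbits Z.step X = 2 * num_orbits Z.step ((\<lambda>x. (x, Along)) ` A)"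
  proof (rule num_orbits_double[OF Z.permutation_step, of rev_arc])
    show "rev_arc y \<in> (\<lambda>x. (x, Along)) ` A \<longleftrightarrow> y \<notin> (\<lambda>x. (x, Along)) ` A" if "y \<in> X" for y
      using that by (cases y; cases "snd y") auto
  qed (use finite_X in \<open>auto simp: Z.step_rev\<close>)
  moreover have "permutation (ot \<circ> nx)"
    using fin permutes_compose[OF nx ot] permutation_permutes by blast
  then have "num_orbits Z.step ((\<lambda>x. (x, Along)) ` A) = num_orbits (ot \<circ> nx) A"
    by (intro num_orbits_image) (auto simp: inj_on_def)
  \<comment> \<open>The \<open>N\<close> transpositions of \<open>ot\<close> lead from the
    components to the loops of the oriented state.\<close>
  moreover have "even (num_orbits (ot \<circ> nx) A + num_orbits nx A + N)"
    by (rule num_orbits_involution_parity)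
      (use fin nx N permutation_permutes permutes_not_in[OF ot] in auto)
  ultimately show ?thesis using num_orbits_step by simp presburger
qed

text \<open>A numbering that fails only on two arcs \<open>a\<close> and \<open>b\<close> is made consistent by exchanging their
  final parts, which is the orientation-respecting smoothing at the virtualized crossing.  It
  increases the number of loops of the state by 1 if \<open>a\<close> and \<open>b\<close> are traversed in the same
  direction, and preserves it if they are traversed in opposite directions.\<close>

lemma parity_defect:
  assumes vU: "\<And>x. x \<in> U \<Longrightarrow> odd (v (ot x) - v x :: int)"
    and N: "card {x \<in> A. ot x \<noteq> x} = 2 * N" and k: "card U = 2 * k"
    and \<delta>: "\<And>x. \<delta> x = v (ot (nx x)) - v x"
    and defect: "(\<forall>x\<in>A. \<delta> x = 0) \<or>
      (\<exists>a\<in>A. \<exists>b\<in>A. a \<noteq> b \<and> \<delta> a = 1 \<and> \<delta> b = -1 \<and> (\<forall>x\<in>A - {a, b}. \<delta> x = 0))"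
  shows "even (card state_loops + num_orbits nx A + N + k) \<longleftrightarrow>
    (\<forall>T\<in>orbit step ` X. (\<Sum>e\<in>T. weight \<delta> e) = 0)"
  using defect
proof
  assume z: "\<forall>x\<in>A. \<delta> x = 0"
  have "even (card state_loops + num_orbits nx A + N + k)"
    by (rule parity_consistent[where v = v, OF _ vU N k]) (use z \<delta> in auto)
  moreover have "(\<Sum>e\<in>T. weight \<delta> e) = 0" if T: "T \<in> orbit step ` X" for T
  proof (rule sum.neutral, rule ballI)
    fix e assume "e \<in> T"
    then have "e \<in> X" using T orbit_sub by blast
    then show "weight \<delta> e = 0" using z by (cases e; cases "snd e") auto
  qed
  ultimately show ?thesis by blast
next
  assume "\<exists>a\<in>A. \<exists>b\<in>A. a \<noteq> b \<and> \<delta> a = 1 \<and> \<delta> b = -1 \<and> (\<forall>x\<in>A - {a, b}. \<delta> x = 0)"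
  then obtain a b where ab: "a \<in> A" "b \<in> A" "a \<noteq> b" "\<delta> a = 1" "\<delta> b = -1"
    and rest: "\<And>x. x \<in> A \<Longrightarrow> x \<noteq> a \<Longrightarrow> x \<noteq> b \<Longrightarrow> \<delta> x = 0" by blast
  let ?t = "Transposition.transpose a b"
  have vab: "v (ot (nx a)) = v a + 1" "v (ot (nx b)) = v b - 1" using ab \<delta>[of a] \<delta>[of b] by auto
  \<comment> \<open>Beginnings and ends of the arcs carry the same values in total, and only on
    \<open>a\<close> and \<open>b\<close> do the parities of the two differ. Their contributions
    must cancel, so \<open>v a\<close> and \<open>v b\<close> have opposite parity.\<close>
  have "even (v b - 1 - v a)"
  proof -
    have bij: "bij_betw (ot \<circ> nx) A A"
      using permutes_imp_bij[OF permutes_compose[OF nx ot]] .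
    have "(\<Sum>x\<in>A. v (ot (nx x)) mod 2) = (\<Sum>x\<in>A. v x mod 2)"
      using sum.reindex_bij_betw[OF bij, of "\<lambda>x. v x mod 2"] by simp
    then have "(\<Sum>x\<in>A. v (ot (nx x)) mod 2 - v x mod 2) = 0" by (simp add: sum_subtractf)
    moreover have "(\<Sum>x\<in>A. v (ot (nx x)) mod 2 - v x mod 2)
        = (\<Sum>x\<in>{a, b}. v (ot (nx x)) mod 2 - v x mod 2)"
      by (rule sum.mono_neutral_right) (use fin ab rest \<delta> in auto)
    ultimately have "(v a + 1) mod 2 - v a mod 2 + ((v b - 1) mod 2 - v b mod 2) = 0"
      using ab(3) vab by simp
    then show ?thesis by presburger
  qed
  interpret R: arc_system A "nx \<circ> ?t" ot U
    by unfold_locales (use fin ot U_sub ot_U ot_neq ab permutes_compose[OF permutes_swap_id nx] in auto)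
  have "even (card R.state_loops + num_orbits (nx \<circ> ?t) A + N + k)"
  proof (rule R.parity_consistent[where v = v, OF _ vU N k])
    fix x assume x: "x \<in> A"
    show "even (v (ot ((nx \<circ> ?t) x)) - v x)"
    proof -
      consider "x = a" | "x = b" "x \<noteq> a" | "x \<noteq> a" "x \<noteq> b" by blast
      then show ?thesis
      proof cases
        case 1
        then have "v (ot ((nx \<circ> ?t) x)) - v x = v b - 1 - v a" using vab by simp
        then show ?thesis using \<open>even (v b - 1 - v a)\<close> by simp
      next
        case 2
        then have "v (ot ((nx \<circ> ?t) x)) - v x = - (v b - 1 - v a)" using vab by simp
        then show ?thesis using \<open>even (v b - 1 - v a)\<close> by (simp only: dvd_minus_iff)
      next
        case 3
        then show ?thesis using rest[OF x] \<delta>[of x] by simp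
      qed
    qed
  qed
  moreover have "odd (num_orbits (nx \<circ> ?t) A + num_orbits nx A)"
  proof -
    have pn: "permutation nx" using nx fin permutation_permutes by blast
    show ?thesis
      using num_orbits_split[OF pn fin _ ab(1,2,3)] num_orbits_merge[OF pn fin _ ab(1,2)] nx
      by (cases "b \<in> orbit nx a") (auto simp: permutes_in_image)
  qed
  ultimately have parity: "odd (card R.state_loops + num_orbits nx A + N + k)" by simp presburger
  define a1 a2 b1 b2 where abd: "a1 = (a, Along)" "a2 = (a, Against)" "b1 = (b, Along)" "b2 = (b, Against)"
  have rev: "rev_arc a1 = a2" "rev_arc b1 = b2" "rev_arc a2 = a1" "rev_arc b2 = b1"
    by (simp_all add: abd)
  have abX: "a1 \<in> X" "a2 \<in> X" "b1 \<in> X" "b2 \<in> X" using ab by (auto simp: abd)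
  have abne: "a1 \<noteq> b1" "a2 \<noteq> b2" using ab by (auto simp: abd)
  note P = permutation_step
  let ?q = "step \<circ> Transposition.transpose a1 b1"
  \<comment> \<open>Forward travel on \<open>a\<close> or \<open>b\<close> leaves through the final
    part of the other arc, so the exchange precedes the step. Backward travel enters through a final
    part, so there the exchange follows the step.\<close>
  have Rstep: "R.step = Transposition.transpose a2 b2 \<circ> ?q"
  proof
    fix e :: "'a \<times> direction"
    have i: "inv (nx \<circ> ?t) x = ?t (inv nx x)" for x
      using o_inv_distrib[of nx ?t] permutes_bij[OF nx] by simp
    obtain x d where e: "e = (x, d)" by (cases e)
    show "R.step e = (Transposition.transpose a2 b2 \<circ> ?q) e"
      unfolding e by (cases d) (auto simp: i abd Transposition.transpose_def)
  qed
  have Q: "permutation ?q" by (rule permutation_comp_transpose[OF P])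
  have qX: "?q e \<in> X" if "e \<in> X" for e
    using that abX by (simp add: Transposition.transpose_def del: step_simps)
  have selfo: "e \<in> orbit step e" for e by (rule permutation_self_in_orbit[OF P])
  have wt: "(\<Sum>e\<in>T. weight \<delta> e) =
      of_bool (a1 \<in> T) - of_bool (a2 \<in> T) - of_bool (b1 \<in> T) + of_bool (b2 \<in> T)"
    if T: "T \<subseteq> X" for T
  proof -
    have "(\<Sum>e\<in>T. weight \<delta> e) = (\<Sum>e\<in>T \<inter> {a1, a2, b1, b2}. weight \<delta> e)"
    proof (rule sum.mono_neutral_right)
      show "\<forall>e\<in>T - T \<inter> {a1, a2, b1, b2}. weight \<delta> e = 0"
      proof
        fix e assume e: "e \<in> T - T \<inter> {a1, a2, b1, b2}"
        obtain x d where xd: "e = (x, d)" by (cases e)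
        show "weight \<delta> e = 0" using e xd T rest[of x] by (cases d) (auto simp: abd)
      qed
    qed (use finite_subset[OF T finite_X] in auto)
    also have "\<dots> = (\<Sum>e\<in>{a1, a2, b1, b2}. if e \<in> T then weight \<delta> e else 0)"
      by (subst sum.inter_restrict[symmetric]) (auto simp: Int_commute)
    also have "\<dots> = of_bool (a1 \<in> T) - of_bool (a2 \<in> T) - of_bool (b1 \<in> T) + of_bool (b2 \<in> T)"
      using ab by (auto simp: abd)
    finally show ?thesis .
  qed
  have ev: "even (\<Sum>e\<in>orbit step a1. weight \<delta> e)"
    unfolding ext[of \<delta>, OF \<delta>] by (rule weight_sum_even[where v = v, OF abX(1) vU])
  have na2: "a2 \<notin> orbit step a1" using rev_notin_orbit[OF abX(1)] rev by simp
  have nb: "b2 \<notin> orbit step b1" using rev_notin_orbit[OF abX(3)] rev by simp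
  \<comment> \<open>The arc \<open>a\<close> contributes 1 and the total is even, so
    \<open>b\<close> lies on the same loop, in exactly one of its two directions.\<close>
  have "b1 \<in> orbit step a1 \<longleftrightarrow> b2 \<notin> orbit step a1"
    using ev wt[OF orbit_sub[OF abX(1)]] na2 selfo[of a1]
    by (cases "b1 \<in> orbit step a1"; cases "b2 \<in> orbit step a1") auto
  then consider "b1 \<in> orbit step a1" "b2 \<notin> orbit step a1"
    | "b1 \<notin> orbit step a1" "b2 \<in> orbit step a1" by blast
  then show ?thesis
  proof cases
    \<comment> \<open>Same direction: the contributions cancel. One transposition splits the orbit
      and the other one its reversal, which gives two more orbits and one more loop.\<close>
    case 1
    have b2a2: "b2 \<in> orbit step a2"
      using imageI[OF 1(1), of rev_arc] orbit_rev[OF abX(1)] rev by simp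
    have "(\<Sum>e\<in>T. weight \<delta> e) = 0" if T: "T \<in> orbit step ` X" for T
    proof -
      obtain e where e: "T = orbit step e" "e \<in> X" using T by blast
      have "a1 \<in> T \<longleftrightarrow> b1 \<in> T" "a2 \<in> T \<longleftrightarrow> b2 \<in> T"
        using 1(1) b2a2 e orbit_eq_iff[OF P] by metis+
      then show ?thesis using wt[of T] e orbit_sub by simp
    qed
    moreover have "num_orbits ?q X = num_orbits step X + 1"
      by (rule num_orbits_split[OF P finite_X _ abX(1,3) abne(1) 1(1)]) simp
    moreover have "num_orbits R.step X = num_orbits ?q X + 1"
      unfolding Rstep
    proof (rule num_orbits_transpose_left_split[OF Q finite_X qX abX(2,4) abne(2)])
      have "a1 \<notin> orbit step a2" using na2 orbit_eq_iff[OF P] selfo by metis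
      moreover have "b1 \<notin> orbit step a2" using na2 1(1) orbit_eq_iff[OF P] selfo by metis
      ultimately show "b2 \<in> orbit ?q a2" using orbit_comp_transpose_other[OF P] b2a2 by metis
    qed
    ultimately have "\<forall>T\<in>orbit step ` X. (\<Sum>e\<in>T. weight \<delta> e) = 0"
      "card R.state_loops = card state_loops + 1"
      using num_orbits_step R.num_orbits_step by auto
    then show ?thesis using parity by auto
  next
    \<comment> \<open>Opposite directions: the contributions add up to 2. The first transposition
      merges the orbit with its reversal and the second splits the result, so the number of loops is
      kept.\<close>
    case 2
    have "(\<Sum>e\<in>orbit step a1. weight \<delta> e) = 2"
      using 2 wt[OF orbit_sub[OF abX(1)]] na2 selfo[of a1] by simp
    then have "\<not> (\<forall>T\<in>orbit step ` X. (\<Sum>e\<in>T. weight \<delta> e) = 0)" using abX(1) by force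
    moreover have "num_orbits step X = num_orbits ?q X + 1"
      by (rule num_orbits_merge[OF P finite_X _ abX(1,3) 2(1)]) simp
    moreover have "num_orbits R.step X = num_orbits ?q X + 1"
      unfolding Rstep
    proof (rule num_orbits_transpose_left_split[OF Q finite_X qX abX(2,4) abne(2)])
      have "b1 \<in> orbit step a2"
        using imageI[OF 2(2), of rev_arc] orbit_rev[OF abX(1)] rev by simp
      then have "a2 \<in> orbit step b1" using orbit_eq_iff[OF P] selfo by metis
      then have "a2 \<in> orbit ?q a1" "b2 \<in> orbit ?q a1"
        using orbit_comp_transpose_merge[OF P 2(1)] 2(2) by auto
      then show "b2 \<in> orbit ?q a2" using orbit_mem_eq[OF Q] by metis
    qed
    ultimately have "\<not> (\<forall>T\<in>orbit step ` X. (\<Sum>e\<in>T. weight \<delta> e) = 0)"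
      "card R.state_loops = card state_loops"
      using num_orbits_step R.num_orbits_step by auto
    then show ?thesis using parity by auto
  qed
qed

end

section \<open>Marks on the loops of a diagram\<close>

lemma frac_add_int [simp]: "frac (s + of_int k) = frac (s :: real)"
  by (simp add: frac_def)

lemma frac_eq_imp_eq:
  fixes s t :: real
  assumes "frac s = frac t" "\<bar>s - t\<bar> < 1"
  shows "s = t"
proof -
  have "s - t = of_int (\<lfloor>s\<rfloor> - \<lfloor>t\<rfloor>)" using assms(1) by (simp add: frac_def)
  moreover from this have "\<lfloor>s\<rfloor> - \<lfloor>t\<rfloor> = 0" using assms(2) by linarith
  ultimately show ?thesis by simp
qed

locale marks =
  fixes M :: "point set"
  assumes finite_marks: "finite M" and marks_range: "x \<in> M \<Longrightarrow> 0 \<le> snd x \<and> snd x < 1"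
begin

text \<open>The marks of a loop are unrolled periodically over the real line, where next and
  previous marks are plain neighbours.\<close>

definition lift :: "nat \<Rightarrow> real set" where
  "lift i = {s. (i, frac s) \<in> M}"

lemma frac_marks: "x \<in> M \<Longrightarrow> frac (snd x) = snd x"
  using marks_range by (simp add: frac_eq)

lemma mem_lift: "x \<in> M \<Longrightarrow> snd x \<in> lift (fst x)"
  using frac_marks by (simp add: lift_def)

lemma lift_shift [simp]: "s + of_int k \<in> lift i \<longleftrightarrow> s \<in> lift i"
  by (simp add: lift_def)

lemma finite_lift: "finite (lift i \<inter> {a..b})"
proof (rule inj_on_finite)
  show "inj_on (\<lambda>s. (frac s, \<lfloor>s\<rfloor>)) (lift i \<inter> {a..b})"
    by (rule inj_onI) (simp add: frac_def)
  show "(\<lambda>s. (frac s, \<lfloor>s\<rfloor>)) ` (lift i \<inter> {a..b}) \<subseteq> snd ` M \<times> {\<lfloor>a\<rfloor>..\<lfloor>b\<rfloor>}"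
    by (force simp: lift_def intro: floor_mono)
qed (simp add: finite_marks)

lemma finite_lift_subset: "S \<subseteq> lift i \<inter> {a..b} \<Longrightarrow> finite S"
  using finite_lift finite_subset by blast

text \<open>The least time exists because the interval of length 1 after \<open>s\<close> contains a
  translate of any lifted mark, but only finitely many lifted marks.\<close>

lemma next_time_props:
  assumes "lift i \<noteq> {}"
  shows "s < next_time M (i, s)" "next_time M (i, s) \<in> lift i" "next_time M (i, s) \<le> s + 1"
    "t \<in> lift i \<Longrightarrow> s < t \<Longrightarrow> next_time M (i, s) \<le> t"
proof -
  define Y where "Y = lift i \<inter> {s<..s + 1}"
  obtain t0 where t0: "t0 \<in> lift i" using assms by blast
  have "t0 + of_int (\<lfloor>s - t0\<rfloor> + 1) \<in> lift i" using t0 lift_shift by blast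
  moreover have "s < t0 + of_int (\<lfloor>s - t0\<rfloor> + 1)" "t0 + of_int (\<lfloor>s - t0\<rfloor> + 1) \<le> s + 1"
    by linarith+
  ultimately have ne: "Y \<noteq> {}" unfolding Y_def by auto
  have fin: "finite Y" unfolding Y_def by (rule finite_lift_subset[of _ i s "s + 1"]) auto
  have m: "Min Y \<in> Y" by (rule Min_in[OF fin ne])
  have least: "Min Y \<le> t" if "t \<in> lift i" "s < t" for t
  proof (cases "t \<le> s + 1")
    case True
    then show ?thesis using that fin by (intro Min_le) (auto simp: Y_def)
  next
    case False
    then show ?thesis using m by (auto simp: Y_def)
  qed
  have "next_time M (i, s) = Min Y"
    unfolding next_time_def
    by (rule Least_equality) (use m least in \<open>auto simp: Y_def lift_def\<close>)
  then show "s < next_time M (i, s)" "next_time M (i, s) \<in> lift i" "next_time M (i, s) \<le> s + 1"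
    "t \<in> lift i \<Longrightarrow> s < t \<Longrightarrow> next_time M (i, s) \<le> t"
    using m least by (auto simp: Y_def)
qed

lemma prev_time_props:
  assumes "lift i \<noteq> {}"
  shows "prev_time M (i, s) < s" "prev_time M (i, s) \<in> lift i"
    "t \<in> lift i \<Longrightarrow> t < s \<Longrightarrow> t \<le> prev_time M (i, s)"
proof -
  define Y where "Y = lift i \<inter> {s - 1..<s}"
  obtain t0 where t0: "t0 \<in> lift i" using assms by blast
  have "t0 + of_int (\<lceil>s - t0\<rceil> - 1) \<in> lift i" using t0 lift_shift by blast
  moreover have "t0 + of_int (\<lceil>s - t0\<rceil> - 1) < s" "s - 1 \<le> t0 + of_int (\<lceil>s - t0\<rceil> - 1)"
    by linarith+
  ultimately have ne: "Y \<noteq> {}" unfolding Y_def by auto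
  have fin: "finite Y" unfolding Y_def by (rule finite_lift_subset[of _ i "s - 1" s]) auto
  have m: "Max Y \<in> Y" by (rule Max_in[OF fin ne])
  have greatest: "t \<le> Max Y" if "t \<in> lift i" "t < s" for t
  proof (cases "s - 1 \<le> t")
    case True
    then show ?thesis using that fin by (intro Max_ge) (auto simp: Y_def)
  next
    case False
    then show ?thesis using m by (auto simp: Y_def)
  qed
  have "prev_time M (i, s) = Max Y"
    unfolding prev_time_def
    by (rule Greatest_equality) (use m greatest in \<open>auto simp: Y_def lift_def\<close>)
  then show "prev_time M (i, s) < s" "prev_time M (i, s) \<in> lift i"
    "t \<in> lift i \<Longrightarrow> t < s \<Longrightarrow> t \<le> prev_time M (i, s)"
    using m greatest by (auto simp: Y_def)
qed

lemma next_prev_time: "s \<in> lift i \<Longrightarrow> next_time M (i, prev_time M (i, s)) = s"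
proof (rule antisym)
  assume s: "s \<in> lift i"
  then have l: "lift i \<noteq> {}" by blast
  let ?p = "prev_time M (i, s)"
  show "next_time M (i, ?p) \<le> s" using next_time_props(4)[OF l s] prev_time_props(1)[OF l] by blast
  show "s \<le> next_time M (i, ?p)"
    using prev_time_props(3)[OF l next_time_props(2)[OF l], of ?p s] next_time_props(1)[OF l, of ?p]
    by linarith
qed

lemma prev_next_time: "s \<in> lift i \<Longrightarrow> prev_time M (i, next_time M (i, s)) = s"
proof (rule antisym)
  assume s: "s \<in> lift i"
  then have l: "lift i \<noteq> {}" by blast
  let ?n = "next_time M (i, s)"
  show "s \<le> prev_time M (i, ?n)" using prev_time_props(3)[OF l s] next_time_props(1)[OF l] by blast
  show "prev_time M (i, ?n) \<le> s"
    using next_time_props(4)[OF l prev_time_props(2)[OF l], of s ?n] prev_time_props(1)[OF l, of ?n]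
    by linarith
qed

lemma next_time_shift: "lift i \<noteq> {} \<Longrightarrow> next_time M (i, s + of_int k) = next_time M (i, s) + of_int k"
proof (rule antisym)
  assume l: "lift i \<noteq> {}"
  show "next_time M (i, s + of_int k) \<le> next_time M (i, s) + of_int k"
    using next_time_props[OF l] by simp
  have "next_time M (i, s + of_int k) + of_int (- k) \<in> lift i"
    using next_time_props(2)[OF l] lift_shift by blast
  moreover have "s < next_time M (i, s + of_int k) + of_int (- k)"
    using next_time_props(1)[OF l, of "s + of_int k"] by simp
  ultimately have "next_time M (i, s) \<le> next_time M (i, s + of_int k) + of_int (- k)"
    by (rule next_time_props(4)[OF l])
  then show "next_time M (i, s) + of_int k \<le> next_time M (i, s + of_int k)" by simp
qed

lemma prev_time_shift: "lift i \<noteq> {} \<Longrightarrow> prev_time M (i, s + of_int k) = prev_time M (i, s) + of_int k"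
proof (rule antisym)
  assume l: "lift i \<noteq> {}"
  show "prev_time M (i, s) + of_int k \<le> prev_time M (i, s + of_int k)"
    using prev_time_props[OF l] by simp
  have "prev_time M (i, s + of_int k) + of_int (- k) \<in> lift i"
    using prev_time_props(2)[OF l] lift_shift by blast
  moreover have "prev_time M (i, s + of_int k) + of_int (- k) < s"
    using prev_time_props(1)[OF l, of "s + of_int k"] by simp
  ultimately have "prev_time M (i, s + of_int k) + of_int (- k) \<le> prev_time M (i, s)"
    by (rule prev_time_props(3)[OF l])
  then show "prev_time M (i, s + of_int k) \<le> prev_time M (i, s) + of_int k" by simp
qed

text \<open>Shift invariance lets the neighbours be computed from any time on the line, not only
  from one in the unit interval.\<close>

lemma mark_frac:
  assumes "lift i \<noteq> {}"
  shows "next_mark M (i, frac s) = (i, frac (next_time M (i, s)))"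
    "prev_mark M (i, frac s) = (i, frac (prev_time M (i, s)))"
proof -
  have s: "s = frac s + of_int \<lfloor>s\<rfloor>" by (simp add: frac_def)
  have "next_time M (i, s) = next_time M (i, frac s) + of_int \<lfloor>s\<rfloor>"
    by (subst s) (rule next_time_shift[OF assms])
  then show "next_mark M (i, frac s) = (i, frac (next_time M (i, s)))"
    by (simp add: next_mark_def)
  have "prev_time M (i, s) = prev_time M (i, frac s) + of_int \<lfloor>s\<rfloor>"
    by (subst s) (rule prev_time_shift[OF assms])
  then show "prev_mark M (i, frac s) = (i, frac (prev_time M (i, s)))"
    by (simp add: prev_mark_def)
qed

lemma fst_mark [simp]: "fst (next_mark M x) = fst x" "fst (prev_mark M x) = fst x"
  by (simp_all add: next_mark_def prev_mark_def)

lemma lift_nonempty: "x \<in> M \<Longrightarrow> lift (fst x) \<noteq> {}"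
  using mem_lift by blast

lemma next_mark_in [simp]: "x \<in> M \<Longrightarrow> next_mark M x \<in> M"
  using next_time_props(2)[OF lift_nonempty, of x "snd x"] by (simp add: next_mark_def lift_def)

lemma prev_mark_in [simp]: "x \<in> M \<Longrightarrow> prev_mark M x \<in> M"
  using prev_time_props(2)[OF lift_nonempty, of x "snd x"] by (simp add: prev_mark_def lift_def)

lemma prev_next_mark [simp]: "x \<in> M \<Longrightarrow> prev_mark M (next_mark M x) = x"
  unfolding next_mark_def
  using mark_frac(2)[OF lift_nonempty] prev_next_time[OF mem_lift] frac_marks by simp

lemma next_prev_mark [simp]: "x \<in> M \<Longrightarrow> next_mark M (prev_mark M x) = x"
  unfolding prev_mark_def
  using mark_frac(1)[OF lift_nonempty] next_prev_time[OF mem_lift] frac_marks by simp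

lemma prev_mark_bij: "bij_betw (prev_mark M) {y \<in> M. fst y = i} {y \<in> M. fst y = i}"
  by (rule bij_betwI[where g = "next_mark M"]) auto

section \<open>Sums and orbits along a loop\<close>

lemma lift_interval_prev:
  assumes b: "b \<in> lift i" and ab: "a < b"
  shows "lift i \<inter> {a<..b} = insert b (lift i \<inter> {a<..prev_time M (i, b)})"
proof -
  have l: "lift i \<noteq> {}" using b by blast
  show ?thesis using b ab prev_time_props(1)[OF l, of b] prev_time_props(3)[OF l, of _ b]
    by (auto simp: le_less)
qed

lemma telescope:
  fixes f :: "point \<Rightarrow> int"
  assumes "a \<in> lift i" "b \<in> lift i" "a \<le> b"
  shows "(\<Sum>s\<in>lift i \<inter> {a<..b}. f (i, frac s) - f (prev_mark M (i, frac s)))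
    = f (i, frac b) - f (i, frac a)"
  using assms(2,3)
proof (induction "card (lift i \<inter> {a<..b})" arbitrary: b rule: less_induct)
  case less
  have l: "lift i \<noteq> {}" using assms(1) by blast
  show ?case
  proof (cases "a = b")
    case True then show ?thesis by simp
  next
    case False
    define c where "c = prev_time M (i, b)"
    have c: "c < b" "c \<in> lift i" "a \<le> c"
      using prev_time_props[OF l] assms(1) False less.prems unfolding c_def by auto
    have I: "lift i \<inter> {a<..b} = insert b (lift i \<inter> {a<..c})"
      unfolding c_def by (rule lift_interval_prev) (use less.prems False in auto)
    have fin: "finite (lift i \<inter> {a<..c})" by (rule finite_lift_subset[of _ i a c]) auto
    have bn: "b \<notin> lift i \<inter> {a<..c}" using c by auto
    have "card (lift i \<inter> {a<..c}) < card (lift i \<inter> {a<..b})" unfolding I using fin bn by simp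
    from less.hyps[OF this c(2,3)] show ?thesis
      unfolding I using fin bn mark_frac(2)[OF l, of b] by (simp add: c_def)
  qed
qed

lemma later_mark_in_orbit:
  assumes "a \<in> lift i" "b \<in> lift i" "a < b"
  shows "(i, frac b) \<in> orbit (next_mark M) (i, frac a)"
  using assms(2,3)
proof (induction "card (lift i \<inter> {a<..b})" arbitrary: b rule: less_induct)
  case less
  have l: "lift i \<noteq> {}" using assms(1) by blast
  define c where "c = prev_time M (i, b)"
  have c: "c < b" "c \<in> lift i" "a \<le> c"
    using prev_time_props[OF l] assms(1) less.prems unfolding c_def by auto
  have nc: "next_mark M (i, frac c) = (i, frac b)"
    using mark_frac(1)[OF l] next_prev_time[OF less.prems(1)] unfolding c_def by simp
  show ?case
  proof (cases "a = c")
    case True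
    then show ?thesis using nc orbit.base[of "next_mark M" "(i, frac a)"] by simp
  next
    case False
    have I: "lift i \<inter> {a<..b} = insert b (lift i \<inter> {a<..c})"
      unfolding c_def by (rule lift_interval_prev) (use less.prems in auto)
    have fin: "finite (lift i \<inter> {a<..c})" by (rule finite_lift_subset[of _ i a c]) auto
    have bn: "b \<notin> lift i \<inter> {a<..c}" using c by auto
    have "card (lift i \<inter> {a<..c}) < card (lift i \<inter> {a<..b})" unfolding I using fin bn by simp
    from less.hyps[OF this c(2)] False c(3) have "(i, frac c) \<in> orbit (next_mark M) (i, frac a)"
      by simp
    then show ?thesis using nc orbit.step by metis
  qed
qed

lemma mark_in_orbit:
  assumes "x \<in> M" "y \<in> M" "fst x = fst y"
  shows "y \<in> orbit (next_mark M) x"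
proof -
  \<comment> \<open>One extra turn places \<open>y\<close> after \<open>x\<close> even if its time
    is not the larger one.\<close>
  have "snd y + of_int 1 \<in> lift (fst x)" using mem_lift[OF assms(2)] assms(3) lift_shift by metis
  moreover have "snd x < snd y + of_int 1"
    using marks_range[OF assms(1)] marks_range[OF assms(2)] by simp
  ultimately have "(fst x, frac (snd y + of_int 1)) \<in> orbit (next_mark M) (fst x, frac (snd x))"
    by (rule later_mark_in_orbit[OF mem_lift[OF assms(1)]])
  then show ?thesis using assms frac_marks frac_add_int by (metis prod.collapse)
qed

lemma piece_points_marks: "x \<in> M \<Longrightarrow> piece_points M (From x) \<inter> M = {}"
proof -
  assume x: "x \<in> M"
  have False if s: "snd x < s" "s < next_time M x" "(fst x, frac s) \<in> M" for s
    using next_time_props(4)[OF lift_nonempty[OF x], of s "snd x"] s by (simp add: lift_def)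
  then show ?thesis by auto
qed

text \<open>Lift two pieces to the line so that a common point gets a single time. Then the later of
  the two starting marks would lie strictly inside the other piece.\<close>

lemma piece_points_disjoint:
  assumes x: "x \<in> M" and y: "y \<in> M" and xy: "x \<noteq> y"
  shows "piece_points M (From x) \<inter> piece_points M (From y) = {}"
proof -
  have aux: False
    if x: "x \<in> M" and y: "y \<in> M" and i: "fst x = fst y" and k: "snd x < snd y + of_int k"
      and s: "s < next_time M x" and t: "snd y < t" and st: "s = t + of_int k" for x y s t k
  proof -
    have "snd y + of_int k \<in> lift (fst x)" using mem_lift[OF y] i by simp
    then have "next_time M x \<le> snd y + of_int k"
      using next_time_props(4)[OF lift_nonempty[OF x] _ k] by simp
    then show False using s t st by simp
  qed
  have False if z: "z \<in> piece_points M (From x)" "z \<in> piece_points M (From y)" for z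
  proof -
    obtain s t where s: "snd x < s" "s < next_time M x" "z = (fst x, frac s)"
      and t: "snd y < t" "t < next_time M y" "z = (fst y, frac t)" using z by auto
    define k where "k = \<lfloor>s\<rfloor> - \<lfloor>t\<rfloor>"
    have st: "s = t + of_int k" "t = s + of_int (- k)" using s(3) t(3) by (auto simp: k_def frac_def)
    have i: "fst x = fst y" using s t by auto
    consider "snd x < snd y + of_int k" | "snd y < snd x + of_int (- k)" | "snd x = snd y + of_int k"
      by (cases "snd x" "snd y + of_int k" rule: linorder_cases) auto
    then show False
    proof cases
      case 1 then show ?thesis using aux[OF x y i _ s(2) t(1) st(1)] by blast
    next
      case 2 then show ?thesis using aux[OF y x i[symmetric] _ t(2) s(1) st(2)] by blast
    next
      case 3
      then have "frac (snd x) = frac (snd y)" by simp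
      then show ?thesis using xy i frac_marks[OF x] frac_marks[OF y] by (simp add: prod_eq_iff)
    qed
  qed
  then show ?thesis by blast
qed

text \<open>\<open>Q\<close> will be the set of passages, and \<open>M\<close> will contain the cut
  points as well. With a numbering for \<open>f\<close>, the jumps at the cut points inside a
  semi-arc add up to the difference between its ends.\<close>

lemma piece_telescope:
  fixes f :: "point \<Rightarrow> int"
  assumes Q: "Q \<subseteq> M" and x: "x \<in> Q"
  shows "(\<Sum>y\<in>M \<inter> piece_points Q (From x). f y - f (prev_mark M y))
    = f (prev_mark M (next_mark Q x)) - f x"
proof -
  interpret Q: marks Q
    by unfold_locales (use Q finite_marks finite_subset marks_range in auto)
  have xM: "x \<in> M" using x Q by blast
  define i where "i = fst x"
  define a where "a = snd x"
  define b where "b = next_time Q x"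
  have l: "lift i \<noteq> {}" unfolding i_def by (rule lift_nonempty[OF xM])
  have ab: "a < b" "b \<le> a + 1" "b \<in> Q.lift i"
    using Q.next_time_props[OF Q.lift_nonempty[OF x], of "snd x"] by (auto simp: a_def b_def i_def)
  have bl: "b \<in> lift i" using ab Q by (auto simp: Q.lift_def lift_def)
  have al: "a \<in> lift i" using mem_lift[OF xM] by (simp add: a_def i_def)
  let ?g = "\<lambda>y. f y - f (prev_mark M y)"
  have set: "M \<inter> piece_points Q (From x) = (\<lambda>s. (i, frac s)) ` (lift i \<inter> {a<..<b})"
    by (auto simp: lift_def i_def a_def b_def)
  \<comment> \<open>The open interval has length at most 1, so no point of the loop is counted
    twice.\<close>
  have inj: "inj_on (\<lambda>s. (i, frac s)) (lift i \<inter> {a<..<b})"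
    by (rule inj_onI) (rule frac_eq_imp_eq, use ab in auto)
  have "(\<Sum>y\<in>M \<inter> piece_points Q (From x). ?g y) = (\<Sum>s\<in>lift i \<inter> {a<..<b}. ?g (i, frac s))"
    unfolding set by (subst sum.reindex[OF inj]) simp
  \<comment> \<open>The telescoping sum includes the end \<open>b\<close>, which is no inner point
    of the piece. Removing its term leaves the value just before \<open>b\<close>.\<close>
  moreover have "lift i \<inter> {a<..b} = insert b (lift i \<inter> {a<..<b})" using bl ab by auto
  moreover have "finite (lift i \<inter> {a<..<b})" by (rule finite_lift_subset[of _ i a b]) auto
  ultimately have "(\<Sum>s\<in>lift i \<inter> {a<..b}. ?g (i, frac s))
      = ?g (i, frac b) + (\<Sum>y\<in>M \<inter> piece_points Q (From x). ?g y)" by simp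
  moreover have "(i, frac b) = next_mark Q x" by (simp add: i_def b_def next_mark_def)
  moreover have "(i, frac a) = x" using frac_marks[OF xM] by (simp add: i_def a_def)
  ultimately show ?thesis using telescope[OF al bl, of f] ab by simp
qed

lemma cyclic_sum:
  fixes f :: "point \<Rightarrow> int"
  shows "(\<Sum>y\<in>{y \<in> M. fst y = i}. f y - f (prev_mark M y)) = 0"
  using sum.reindex_bij_betw[OF prev_mark_bij, of f] by (simp add: sum_subtractf)

end

section \<open>States of a diagram as states of its system of semi-arcs\<close>

locale link_diagram =
  fixes D :: diagram
  assumes diagram: "virtual_link_diagram D"
begin

lemma finite_crossings: "finite (crossings D)"
  using diagram by (simp add: virtual_link_diagram_def)

lemma classical_crossings: "classical D \<subseteq> crossings D"
  using diagram by (auto simp: virtual_link_diagram_def classical_def dom_def)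

lemma finite_classical: "finite (classical D)"
  using finite_subset[OF classical_crossings finite_crossings] .

lemma det2_nonzero:
  "x \<in> preimages D p \<Longrightarrow> y \<in> preimages D p \<Longrightarrow> x \<noteq> y \<Longrightarrow> det2 (velocity D x) (velocity D y) \<noteq> 0"
  using diagram unfolding virtual_link_diagram_def by (elim conjE) blast

lemma finite_preimages: "finite (preimages D p)"
  using diagram unfolding virtual_link_diagram_def by (elim conjE) (drule spec, erule conjunct1)

lemma card_preimages: "p \<in> classical D \<Longrightarrow> card (preimages D p) = 2"
  using classical_crossings by (auto simp: crossings_def)

lemma passage_iff: "x \<in> passages D \<longleftrightarrow> position D x \<in> classical D \<and> x \<in> preimages D (position D x)"
  by (auto simp: passages_def preimages_def)

lemma preimages_position: "x \<in> preimages D p \<Longrightarrow> position D x = p"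
  by (simp add: preimages_def)

lemma other_props:
  assumes "x \<in> passages D"
  shows "other D x \<noteq> x" "preimages D (position D x) = {x, other D x}"
    "position D (other D x) = position D x" "other D x \<in> passages D" "other D (other D x) = x"
proof -
  let ?p = "position D x"
  have x: "x \<in> preimages D ?p" "?p \<in> classical D" using assms by (simp_all add: passage_iff)
  obtain u v where uv: "preimages D ?p = {u, v}" "u \<noteq> v"
    using card_preimages[OF x(2)] by (auto simp only: card_2_iff)
  define y where "y = (if x = u then v else u)"
  have y: "y \<noteq> x" "preimages D ?p = {x, y}"
    using uv x(1) by (auto simp: y_def simp del: prod.inject)
  have oy: "other D x = y" unfolding other_def by (rule the_equality) (use y in auto)
  have py: "position D y = ?p" using y preimages_position by blast
  have "other D y = x" unfolding other_def py by (rule the_equality) (use y in auto)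
  then show "other D x \<noteq> x" "preimages D ?p = {x, other D x}"
    "position D (other D x) = ?p" "other D x \<in> passages D" "other D (other D x) = x"
    using y oy py x by (auto simp: passage_iff)
qed

lemma card_passages_over:
  assumes "Q \<subseteq> classical D"
  shows "card {x \<in> passages D. position D x \<in> Q} = 2 * card Q"
proof -
  have "{x \<in> passages D. position D x \<in> Q} = (\<Union>p\<in>Q. preimages D p)"
    using assms by (auto simp: passage_iff preimages_def)
  moreover have "card (\<Union>p\<in>Q. preimages D p) = (\<Sum>p\<in>Q. card (preimages D p))"
  proof (rule card_UN_disjoint)
    show "finite Q" using finite_subset[OF assms finite_classical] .
    show "\<forall>p\<in>Q. finite (preimages D p)" using finite_preimages by blast
  qed (auto simp: preimages_def)
  moreover have "\<dots> = (\<Sum>p\<in>Q. 2)"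
    using assms card_preimages by (intro sum.cong) auto
  ultimately show ?thesis by simp
qed

lemma finite_passages: "finite (passages D)"
proof -
  have "passages D \<subseteq> (\<Union>p\<in>classical D. preimages D p)" by (auto simp: passage_iff)
  moreover have "finite (\<Union>p\<in>classical D. preimages D p)"
    using finite_preimages finite_classical by blast
  ultimately show ?thesis by (rule finite_subset)
qed

section \<open>The semi-arcs as an arc system\<close>

sublocale marks "passages D"
proof
  show "finite (passages D)" by (rule finite_passages)
qed (auto simp: passages_def points_def)

text \<open>The identity outside the semi-arcs is what \<open>permutes\<close> demands. A loop
  without passages is its own successor.\<close>

definition nxt :: "piece \<Rightarrow> piece" where
  "nxt a = (case a of From x \<Rightarrow> From (if x \<in> passages D then next_mark (passages D) x else x)
     | Whole i \<Rightarrow> Whole i)"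

definition oth :: "piece \<Rightarrow> piece" where
  "oth a = (case a of From x \<Rightarrow> From (if x \<in> passages D then other D x else x) | Whole i \<Rightarrow> Whole i)"

definition nonoriented :: "state \<Rightarrow> piece set" where
  "nonoriented \<sigma> = From ` {x \<in> passages D. \<not> respects_orientation D \<sigma> (position D x)}"

lemma nxt_simps [simp]: "x \<in> passages D \<Longrightarrow> nxt (From x) = From (next_mark (passages D) x)"
  "nxt (Whole i) = Whole i"
  by (simp_all add: nxt_def)

lemma oth_simps [simp]: "x \<in> passages D \<Longrightarrow> oth (From x) = From (other D x)"
  "oth (Whole i) = Whole i"
  by (simp_all add: oth_def)

lemma From_semi_arc [simp]: "From x \<in> semi_arcs D \<longleftrightarrow> x \<in> passages D"
  by (auto simp: semi_arcs_def)

lemma Whole_semi_arc: "Whole i \<in> semi_arcs D \<longleftrightarrow> i < components D \<and> (\<forall>t. (i, t) \<notin> passages D)"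
  by (auto simp: semi_arcs_def)

lemma From_nonoriented [simp]: "From x \<in> nonoriented \<sigma> \<longleftrightarrow>
    x \<in> passages D \<and> \<not> respects_orientation D \<sigma> (position D x)"
  by (auto simp: nonoriented_def)

lemma Whole_nonoriented [simp]: "Whole i \<notin> nonoriented \<sigma>"
  by (auto simp: nonoriented_def)

lemma finite_semi_arcs: "finite (semi_arcs D)"
  using finite_passages by (simp add: semi_arcs_def)

lemma nxt_permutes: "nxt permutes semi_arcs D"
proof (rule bij_imp_permutes)
  let ?g = "\<lambda>a. case a of From x \<Rightarrow> From (prev_mark (passages D) x) | Whole i \<Rightarrow> Whole i"
  show "bij_betw nxt (semi_arcs D) (semi_arcs D)"
  proof (rule bij_betwI[where g = ?g])
    show "nxt \<in> semi_arcs D \<rightarrow> semi_arcs D"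
    proof
      fix a assume "a \<in> semi_arcs D" then show "nxt a \<in> semi_arcs D" by (cases a) auto
    qed
    show "?g \<in> semi_arcs D \<rightarrow> semi_arcs D"
    proof
      fix a assume "a \<in> semi_arcs D" then show "?g a \<in> semi_arcs D" by (cases a) auto
    qed
    show "?g (nxt a) = a" if "a \<in> semi_arcs D" for a
      using that by (cases a) (simp_all del: split_paired_All)
    show "nxt (?g a) = a" if "a \<in> semi_arcs D" for a
      using that by (cases a) simp_all
  qed
qed (auto simp: nxt_def split: piece.splits)

lemma oth_oth: "oth (oth a) = a"
  by (cases a) (auto simp: oth_def other_props)

lemma oth_permutes: "oth permutes semi_arcs D"
  unfolding permutes_def
proof (intro conjI allI impI)
  show "oth a = a" if "a \<notin> semi_arcs D" for a
    using that by (cases a) (auto simp: oth_def)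
  show "\<exists>!a. oth a = b" for b by (metis oth_oth)
qed

sublocale arcs: arc_system "semi_arcs D" nxt oth "nonoriented \<sigma>" for \<sigma>
proof
  show "oth x \<in> nonoriented \<sigma>" if "x \<in> nonoriented \<sigma>" for x
    using that by (cases x) (auto simp: other_props)
  show "oth x \<noteq> x" if "x \<in> nonoriented \<sigma>" for x
    using that by (cases x) (auto simp: other_props)
  show "nonoriented \<sigma> \<subseteq> semi_arcs D" by (auto simp: nonoriented_def)
qed (fact finite_semi_arcs nxt_permutes oth_permutes oth_oth)+

lemma inv_nxt: "x \<in> passages D \<Longrightarrow> inv nxt (From x) = From (prev_mark (passages D) x)"
  using permutes_inverses(2)[OF nxt_permutes, of "From (prev_mark (passages D) x)"] by simp

lemma inv_nxt_Whole: "inv nxt (Whole i) = Whole i"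
  using permutes_inverses(2)[OF nxt_permutes, of "Whole i"] by simp

lemma travel_eq_step:
  assumes "e \<in> semi_arcs D \<times> UNIV"
  shows "travel D \<sigma> e = arcs.step \<sigma> e"
proof (cases e)
  case (Pair a d)
  then show ?thesis using assms
    by (cases a; cases d) (auto simp: Let_def outgoing_def incoming_def inv_nxt inv_nxt_Whole other_props)
qed

lemma orbit_travel:
  assumes "e \<in> semi_arcs D \<times> UNIV"
  shows "orbit (travel D \<sigma>) e = orbit (arcs.step \<sigma>) e"
  by (rule orbit_cong0[OF assms]) (use travel_eq_step arcs.step_in in \<open>auto simp del: arcs.step_simps\<close>)

lemma traversals_eq: "traversals D \<sigma> = orbit (arcs.step \<sigma>) ` (semi_arcs D \<times> UNIV)"
  unfolding traversals_def by (rule image_cong) (simp_all only: orbit_travel)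

lemma finite_traversals: "finite (traversals D \<sigma>)"
  unfolding traversals_eq using finite_semi_arcs by simp

lemma sharp_eq: "sharp D \<sigma> = card (arcs.state_loops \<sigma>)"
  by (simp add: sharp_def loops_def traversals_eq arcs.state_loops_def)

section \<open>Components as orbits of semi-arcs\<close>

fun component_of :: "piece \<Rightarrow> nat" where
  "component_of (From x) = fst x"
| "component_of (Whole i) = i"

text \<open>By \<open>mark_in_orbit\<close>, going round a component with passages meets all its
  semi-arcs. A component without passages is one semi-arc.\<close>

lemma orbit_nxt:
  assumes a: "a \<in> semi_arcs D"
  shows "orbit nxt a = {b \<in> semi_arcs D. component_of b = component_of a}"
proof (intro equalityI subsetI)
  fix b assume "b \<in> orbit nxt a"
  moreover have "orbit nxt a \<subseteq> {b \<in> semi_arcs D. component_of b = component_of a}"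
  proof (rule orbit_subset_closed)
    show "nxt c \<in> {b \<in> semi_arcs D. component_of b = component_of a}"
      if "c \<in> {b \<in> semi_arcs D. component_of b = component_of a}" for c
      using that by (cases c) auto
  qed (simp add: a)
  ultimately show "b \<in> {b \<in> semi_arcs D. component_of b = component_of a}" by blast
next
  fix b assume b: "b \<in> {b \<in> semi_arcs D. component_of b = component_of a}"
  have perm: "permutation nxt"
    using nxt_permutes finite_semi_arcs permutation_permutes by blast
  have not_both: False if "From x \<in> semi_arcs D" "Whole (fst x) \<in> semi_arcs D" for x
    using that by (auto simp: Whole_semi_arc) (metis prod.collapse)
  show "b \<in> orbit nxt a"
  proof (cases a; cases b)
    fix x y assume xy: "a = From x" "b = From y"
    have P: "x \<in> passages D" "y \<in> passages D" "fst x = fst y" using a b xy by auto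
    have "z \<in> passages D \<and> From z \<in> orbit nxt (From x)" if "z \<in> orbit (next_mark (passages D)) x" for z
      using that
    proof induct
      case base then show ?case using P orbit.base[of nxt "From x"] by simp
    next
      case (step z) then show ?case using orbit.step[of "From z" nxt "From x"] by simp
    qed
    then show ?thesis using mark_in_orbit[OF P] xy by blast
  next
    fix x i assume "a = From x" "b = Whole i"
    then show ?thesis using a b not_both[of x] by auto
  next
    fix i x assume "a = Whole i" "b = From x"
    then show ?thesis using a b not_both[of x] by auto
  next
    fix i j assume "a = Whole i" "b = Whole j"
    then show ?thesis using b permutation_self_in_orbit[OF perm, of a] by simp
  qed
qed

lemma num_orbits_nxt: "num_orbits nxt (semi_arcs D) = components D"
proof -
  let ?h = "\<lambda>i. {b \<in> semi_arcs D. component_of b = i}"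
  have "orbit nxt ` semi_arcs D = ?h ` component_of ` semi_arcs D"
    unfolding image_image by (rule image_cong) (simp_all add: orbit_nxt)
  moreover have "inj_on ?h (component_of ` semi_arcs D)"
    by (rule inj_onI) blast
  moreover have "component_of ` semi_arcs D = {..<components D}"
  proof (intro equalityI subsetI)
    fix i assume "i \<in> component_of ` semi_arcs D"
    then show "i \<in> {..<components D}"
      by (auto simp: semi_arcs_def passages_def points_def)
  next
    fix i assume i: "i \<in> {..<components D}"
    show "i \<in> component_of ` semi_arcs D"
    proof (cases "\<exists>t. (i, t) \<in> passages D")
      case True
      then obtain t where "(i, t) \<in> passages D" by blast
      then show ?thesis by (intro image_eqI[of _ _ "From (i, t)"]) auto
    next
      case False
      then show ?thesis using i by (intro image_eqI[of _ _ "Whole i"]) (auto simp: Whole_semi_arc)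
    qed
  qed
  ultimately show ?thesis by (simp add: num_orbits_def card_image)
qed

lemma card_moved: "card {a \<in> semi_arcs D. oth a \<noteq> a} = 2 * card (classical D)"
proof -
  have "{a \<in> semi_arcs D. oth a \<noteq> a} = From ` {x \<in> passages D. position D x \<in> classical D}"
    by (auto simp: semi_arcs_def other_props passage_iff)
  then show ?thesis using card_passages_over[of "classical D"] by (simp add: card_image inj_on_def)
qed

lemma card_nonoriented:
  "card (nonoriented \<sigma>) = 2 * card {p \<in> classical D. \<not> respects_orientation D \<sigma> p}"
proof -
  have "nonoriented \<sigma> = From ` {x \<in> passages D. position D x \<in> {p \<in> classical D. \<not> respects_orientation D \<sigma> p}}"
    by (auto simp: nonoriented_def passage_iff)
  then show ?thesis
    using card_passages_over[of "{p \<in> classical D. \<not> respects_orientation D \<sigma> p}"]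
    by (simp add: card_image inj_on_def)
qed

lemma piece_points_disjoint:
  assumes "a \<in> semi_arcs D" "b \<in> semi_arcs D" "a \<noteq> b"
  shows "piece_points (passages D) a \<inter> piece_points (passages D) b = {}"
proof -
  have not_both: False if "From x \<in> semi_arcs D" "Whole (fst x) \<in> semi_arcs D" for x
    using that by (auto simp: Whole_semi_arc) (metis prod.collapse)
  show ?thesis
  proof (cases a; cases b)
    fix x y assume "a = From x" "b = From y"
    then show ?thesis using assms piece_points_disjoint[of x y] by (simp del: piece_points.simps)
  next
    fix x i assume "a = From x" "b = Whole i"
    then show ?thesis using assms not_both[of x] by auto
  next
    fix x i assume "a = Whole i" "b = From x"
    then show ?thesis using assms not_both[of x] by auto
  qed (use assms in auto)
qed


section \<open>Alexander numberings and indices\<close>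

text \<open>Unlike in a cut system, cut points at virtual crossings are allowed.\<close>

definition numbered_cuts :: "cuts \<Rightarrow> (piece \<Rightarrow> int) \<Rightarrow> bool" where
  "numbered_cuts C \<phi> \<longleftrightarrow> alexander_numbering D C \<phi> \<and> finite (dom C) \<and> dom C \<subseteq> points D \<and>
     dom C \<inter> passages D = {}"

text \<open>A semi-arc stands for the mark at which it begins: this is the value just before that
  mark, and \<open>out_val\<close> the value just after it. The default 0 fits because the cut
  points on a loop without passages cancel.\<close>

definition in_val :: "cuts \<Rightarrow> (piece \<Rightarrow> int) \<Rightarrow> piece \<Rightarrow> int" where
  "in_val C \<phi> a = (case a of From x \<Rightarrow> \<phi> (incoming (passages D \<union> dom C) x) | Whole i \<Rightarrow> 0)"

definition out_val :: "(piece \<Rightarrow> int) \<Rightarrow> piece \<Rightarrow> int" where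
  "out_val \<phi> a = (case a of From x \<Rightarrow> \<phi> (outgoing x) | Whole i \<Rightarrow> 0)"

text \<open>The jump at a crossing depends only on the two velocities, so it is common to all
  numberings.\<close>

definition turn :: "point \<Rightarrow> int" where
  "turn x = (if det2 (velocity D x) (velocity D (other D x)) > 0 then -1 else 1)"

lemma numbering_at_crossing:
  assumes "numbered_cuts C \<phi>" and x: "x \<in> passages D"
  shows "in_val C \<phi> (From x) = out_val \<phi> (From (other D x))"
    "in_val C \<phi> (From x) - out_val \<phi> (From x) = turn x"
proof -
  let ?y = "other D x"
  let ?M = "passages D \<union> dom C"
  let ?p = "position D x"
  have pre: "x \<in> preimages D ?p" "?y \<in> preimages D ?p" "?p \<in> classical D" "x \<noteq> ?y"
    using x other_props[OF x] by (auto simp: passage_iff)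
  have anti: "det2 (velocity D ?y) (velocity D x) = - det2 (velocity D x) (velocity D ?y)"
    by (simp add: det2_def)
  have num: "\<phi> (incoming ?M x') = \<phi> (outgoing y') \<and> \<phi> (incoming ?M y') = \<phi> (outgoing y') + 1 \<and>
      \<phi> (outgoing x') = \<phi> (outgoing y') + 1"
    if "x' \<in> preimages D ?p" "y' \<in> preimages D ?p" "x' \<noteq> y'"
      "det2 (velocity D x') (velocity D y') > 0" for x' y'
    using assms(1) that pre(3) unfolding numbered_cuts_def alexander_numbering_def Let_def by force
  have "in_val C \<phi> (From x) = out_val \<phi> (From ?y) \<and> in_val C \<phi> (From x) - out_val \<phi> (From x) = turn x"
  proof (cases "det2 (velocity D x) (velocity D ?y) > 0")
    case True
    then show ?thesis using num[OF pre(1,2,4)] by (simp add: in_val_def out_val_def turn_def)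
  next
    case False
    then have "det2 (velocity D ?y) (velocity D x) > 0"
      using det2_nonzero[OF pre(1,2,4)] anti by simp
    then show ?thesis using num[OF pre(2,1)] pre(4) False by (simp add: in_val_def out_val_def turn_def)
  qed
  then show "in_val C \<phi> (From x) = out_val \<phi> (From ?y)"
    "in_val C \<phi> (From x) - out_val \<phi> (From x) = turn x" by simp_all
qed

lemma in_val_oth: "numbered_cuts C \<phi> \<Longrightarrow> a \<in> semi_arcs D \<Longrightarrow> in_val C \<phi> a = out_val \<phi> (oth a)"
  using numbering_at_crossing(1) by (cases a) (auto, simp add: in_val_def out_val_def)

text \<open>The numbering jumps by 1 at each cut point, up or down according to its direction, and
  the jumps telescope along the semi-arc.\<close>

lemma cuts_on_eq:
  assumes nc: "numbered_cuts C \<phi>" and a: "a \<in> semi_arcs D"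
  shows "int (cuts_on D C a Along) - int (cuts_on D C a Against) = in_val C \<phi> (nxt a) - out_val \<phi> a"
proof -
  let ?M = "passages D \<union> dom C"
  interpret M: marks ?M
    by unfold_locales (use nc finite_passages marks_range in \<open>auto simp: numbered_cuts_def points_def\<close>)
  let ?f = "\<lambda>y. \<phi> (From y) - \<phi> (From (prev_mark ?M y))"
  have count: "(\<Sum>y\<in>S. ?f y)
      = int (card {y \<in> S. C y = Some Along}) - int (card {y \<in> S. C y = Some Against})"
    if S: "S \<subseteq> dom C" for S
  proof -
    have fin: "finite S" using S nc finite_subset by (auto simp: numbered_cuts_def)
    have "(\<Sum>y\<in>S. ?f y) = (\<Sum>y\<in>S. of_bool (C y = Some Along) - of_bool (C y = Some Against))"
    proof (rule sum.cong[OF refl])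
      fix y assume "y \<in> S"
      then obtain d where d: "C y = Some d" using S by blast
      have "d = Along \<Longrightarrow> \<phi> (outgoing y) = \<phi> (incoming ?M y) + 1"
        "d = Against \<Longrightarrow> \<phi> (incoming ?M y) = \<phi> (outgoing y) + 1"
        using nc d unfolding numbered_cuts_def alexander_numbering_def Let_def by blast+
      then show "?f y = of_bool (C y = Some Along) - of_bool (C y = Some Against)"
        using d by (cases d) (auto simp: outgoing_def incoming_def)
    qed
    also have "\<dots> = int (card {y \<in> S. C y = Some Along}) - int (card {y \<in> S. C y = Some Against})"
      using fin by (simp add: sum_subtractf Int_def)
    finally show ?thesis .
  qed
  show ?thesis
  proof (cases a)
    case (From x)
    then have x: "x \<in> passages D" using a by simp
    let ?S = "?M \<inter> piece_points (passages D) (From x)"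
    have S: "?S \<subseteq> dom C" using piece_points_marks[OF x] by blast
    have "{y \<in> ?S. C y = Some d} = {y \<in> piece_points (passages D) (From x). C y = Some d}" for d
      by auto
    then have "(\<Sum>y\<in>?S. ?f y) = int (cuts_on D C a Along) - int (cuts_on D C a Against)"
      unfolding count[OF S] cuts_on_def From by (simp only:)
    moreover have "(\<Sum>y\<in>?S. ?f y)
        = \<phi> (From (prev_mark ?M (next_mark (passages D) x))) - \<phi> (From x)"
      by (rule M.piece_telescope[of "passages D" x "\<lambda>y. \<phi> (From y)"]) (use x in auto)
    ultimately show ?thesis using x From by (simp add: in_val_def out_val_def incoming_def outgoing_def)
  next
    case (Whole i)
    let ?S = "{y \<in> ?M. fst y = i}"
    have i: "(i, t) \<notin> passages D" for t using a Whole by (simp add: Whole_semi_arc)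
    have S: "?S \<subseteq> dom C" using i by auto
    have "{y \<in> ?S. C y = Some d} = {y \<in> piece_points (passages D) (Whole i). C y = Some d}" for d
      using nc by (auto simp: numbered_cuts_def points_def)
    then have "(\<Sum>y\<in>?S. ?f y) = int (cuts_on D C a Along) - int (cuts_on D C a Against)"
      unfolding count[OF S] cuts_on_def Whole by (simp only:)
    moreover have "(\<Sum>y\<in>?S. ?f y) = 0" by (rule M.cyclic_sum)
    ultimately show ?thesis using Whole by (simp add: in_val_def out_val_def)
  qed
qed

text \<open>The value at the end of the semi-arc is read off just after the same crossing on the
  other strand, so the formula mentions no cut points.\<close>

definition arc_rise :: "(piece \<Rightarrow> int) \<Rightarrow> piece \<Rightarrow> int" where
  "arc_rise \<phi> a = out_val \<phi> (oth (nxt a)) - out_val \<phi> a"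

lemma cuts_on_arc_rise:
  assumes nc: "numbered_cuts C \<phi>" and a: "a \<in> semi_arcs D"
  shows "int (cuts_on D C a Along) - int (cuts_on D C a Against) = arc_rise \<phi> a"
proof -
  have "nxt a \<in> semi_arcs D" using a arcs.in_A by blast
  then show ?thesis unfolding arc_rise_def using cuts_on_eq[OF nc a] in_val_oth[OF nc] by simp
qed

lemma out_val_turn:
  assumes nc: "numbered_cuts C \<phi>" and x: "x \<in> passages D"
  shows "out_val \<phi> (From (other D x)) - out_val \<phi> (From x) = turn x"
  using numbering_at_crossing[OF nc x] by simp

lemma odd_turn: "odd (turn x)"
  by (simp add: turn_def)

lemma cut_sum:
  assumes nc: "numbered_cuts C \<phi>" and T: "T \<in> traversals D \<sigma>"
  shows "(\<Sum>(a, d)\<in>T. int (cuts_on D C a d) - int (cuts_on D C a (opposite d)))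
    = (\<Sum>e\<in>T. weight (arc_rise \<phi>) e)"
proof (rule sum.cong[OF refl])
  fix e assume "e \<in> T"
  then have "e \<in> semi_arcs D \<times> UNIV" using T arcs.orbit_sub unfolding traversals_eq by blast
  then show "(case e of (a, d) \<Rightarrow> int (cuts_on D C a d) - int (cuts_on D C a (opposite d)))
      = weight (arc_rise \<phi>) e"
    using cuts_on_arc_rise[OF nc] by (cases e; cases "snd e") force+
qed

lemma odd_rise_nonoriented:
  assumes nc: "numbered_cuts C \<phi>" and a: "a \<in> nonoriented \<sigma>"
  shows "odd (out_val \<phi> (oth a) - out_val \<phi> a)"
proof -
  obtain x where x: "a = From x" "x \<in> passages D" using a by (auto simp: nonoriented_def)
  then show ?thesis using out_val_turn[OF nc x(2)] odd_turn by simp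
qed

text \<open>Two numberings have the same jumps at the non-oriented smoothings, so the cut points met
  along a loop do not depend on the cut system.\<close>

lemma cut_sum_unique:
  assumes nc: "numbered_cuts C \<phi>" "numbered_cuts C' \<phi>'" and T: "T \<in> traversals D \<sigma>"
  shows "(\<Sum>e\<in>T. weight (arc_rise \<phi>) e) = (\<Sum>e\<in>T. weight (arc_rise \<phi>') e)"
proof -
  obtain e where e: "e \<in> semi_arcs D \<times> UNIV" "T = orbit (arcs.step \<sigma>) e"
    using T unfolding traversals_eq by blast
  let ?uO = "\<lambda>a. out_val \<phi> a - out_val \<phi>' a"
  have "(\<Sum>f\<in>orbit (arcs.step \<sigma>) e. weight (\<lambda>a. ?uO (oth (nxt a)) - ?uO a) f) = 0"
  proof (rule arcs.weight_sum_zero[OF e(1), where uI = "\<lambda>a. ?uO (oth a)"])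
    fix a assume "a \<in> nonoriented \<sigma>"
    then obtain x where "a = From x" "x \<in> passages D" by (auto simp: nonoriented_def)
    then show "?uO (oth a) = ?uO a"
      using out_val_turn[OF nc(1), of x] out_val_turn[OF nc(2), of x] by simp
  qed simp
  moreover have "weight (\<lambda>a. ?uO (oth (nxt a)) - ?uO a) f
      = weight (arc_rise \<phi>) f - weight (arc_rise \<phi>') f" for f
    by (cases f; cases "snd f") (auto simp: arc_rise_def)
  ultimately show ?thesis using e(2) by (simp add: sum_subtractf)
qed

lemma index_eq:
  assumes "numbered_cuts C \<phi>" "numbered_cuts C' \<phi>'" and "T \<in> traversals D \<sigma>"
  shows "index D C T = nat \<bar>\<Sum>e\<in>T. weight (arc_rise \<phi>') e\<bar> div 2"
  unfolding index_def using cut_sum[OF assms(1,3)] cut_sum_unique[OF assms] by simp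

text \<open>Each cut point lies on at most one semi-arc, so a rise is 0, 1 or -1. The rises sum to
  0, because \<open>oth \<circ> nxt\<close> permutes the semi-arcs; so if one of the two values 1
  and -1 occurs, the other does too.\<close>

lemma arc_rise_two_cuts:
  assumes nc: "numbered_cuts [x \<mapsto> Along, y \<mapsto> Against] \<phi>" and xy: "x \<noteq> y"
  shows "(\<forall>a\<in>semi_arcs D. arc_rise \<phi> a = 0) \<or>
      (\<exists>a\<in>semi_arcs D. \<exists>b\<in>semi_arcs D. a \<noteq> b \<and> arc_rise \<phi> a = 1 \<and> arc_rise \<phi> b = -1 \<and>
        (\<forall>c\<in>semi_arcs D - {a, b}. arc_rise \<phi> c = 0))"
proof (rule disjCI)
  let ?A = "semi_arcs D"
  let ?C = "[x \<mapsto> Along, y \<mapsto> Against]"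
  let ?pp = "piece_points (passages D)"
  assume neg: "\<not> (\<exists>a\<in>?A. \<exists>b\<in>?A. a \<noteq> b \<and> arc_rise \<phi> a = 1 \<and> arc_rise \<phi> b = -1 \<and>
        (\<forall>c\<in>?A - {a, b}. arc_rise \<phi> c = 0))"
  have rise: "arc_rise \<phi> a = of_bool (x \<in> ?pp a) - of_bool (y \<in> ?pp a)" if "a \<in> ?A" for a
  proof -
    have "{z \<in> ?pp a. ?C z = Some Along} = (if x \<in> ?pp a then {x} else {})"
      "{z \<in> ?pp a. ?C z = Some Against} = (if y \<in> ?pp a then {y} else {})"
      using xy by auto
    then show ?thesis using cuts_on_arc_rise[OF nc that] unfolding cuts_on_def
      by (simp only:) (auto simp del: fun_upd_apply)
  qed
  have "bij_betw (oth \<circ> nxt) ?A ?A"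
    using permutes_imp_bij[OF permutes_compose[OF nxt_permutes oth_permutes]] .
  then have "(\<Sum>a\<in>?A. out_val \<phi> (oth (nxt a))) = (\<Sum>a\<in>?A. out_val \<phi> a)"
    using sum.reindex_bij_betw[of "oth \<circ> nxt" ?A ?A "out_val \<phi>"] by simp
  then have sum0: "(\<Sum>a\<in>?A. arc_rise \<phi> a) = 0" by (simp add: arc_rise_def sum_subtractf)
  show "\<forall>a\<in>?A. arc_rise \<phi> a = 0"
  proof (rule ccontr)
    assume nz: "\<not> (\<forall>a\<in>?A. arc_rise \<phi> a = 0)"
    have "\<exists>a\<in>?A. arc_rise \<phi> a > 0"
    proof (rule ccontr)
      assume "\<not> (\<exists>a\<in>?A. arc_rise \<phi> a > 0)"
      then have "\<forall>a\<in>?A. arc_rise \<phi> a = 0"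
        using sum0 sum_nonneg_eq_0_iff[OF finite_semi_arcs, of "\<lambda>a. - arc_rise \<phi> a"]
        by (force simp: sum_negf)
      then show False using nz by blast
    qed
    moreover have "\<exists>a\<in>?A. arc_rise \<phi> a < 0"
    proof (rule ccontr)
      assume "\<not> (\<exists>a\<in>?A. arc_rise \<phi> a < 0)"
      then have "\<forall>a\<in>?A. arc_rise \<phi> a = 0"
        using sum0 sum_nonneg_eq_0_iff[OF finite_semi_arcs, of "arc_rise \<phi>"] by force
      then show False using nz by blast
    qed
    ultimately obtain a b where ab: "a \<in> ?A" "b \<in> ?A" "arc_rise \<phi> a > 0" "arc_rise \<phi> b < 0" by blast
    have pa: "x \<in> ?pp a" "y \<notin> ?pp a" using ab rise[OF ab(1)] by (auto simp: of_bool_def split: if_splits)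
    have pb: "x \<notin> ?pp b" "y \<in> ?pp b" using ab rise[OF ab(2)] by (auto simp: of_bool_def split: if_splits)
    have "arc_rise \<phi> c = 0" if c: "c \<in> ?A - {a, b}" for c
    proof -
      have "x \<notin> ?pp c" "y \<notin> ?pp c"
        using piece_points_disjoint[of c a] piece_points_disjoint[of c b] c ab pa pb by blast+
      then show ?thesis using rise c by simp
    qed
    moreover have "a \<noteq> b" using pa pb by blast
    moreover have "arc_rise \<phi> a = 1" "arc_rise \<phi> b = -1" using rise ab pa pb by auto
    ultimately show False using neg ab by blast
  qed
qed

text \<open>Indices do not depend on the cut points, so they may be computed from \<open>x\<close>
  and \<open>y\<close>, to which \<open>parity_defect\<close> applies.\<close>

lemma parity_of_loops:
  assumes nc: "numbered_cuts C \<phi>" and nc': "numbered_cuts [x \<mapsto> Along, y \<mapsto> Against] \<phi>'" and xy: "x \<noteq> y"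
  shows "even (sharp D \<sigma> + components D + card (classical D)
      + card {p \<in> classical D. \<not> respects_orientation D \<sigma> p}) \<longleftrightarrow>
    (\<forall>T\<in>traversals D \<sigma>. index D C T = 0)"
proof -
  have "even (card (arcs.state_loops \<sigma>) + num_orbits nxt (semi_arcs D) + card (classical D)
      + card {p \<in> classical D. \<not> respects_orientation D \<sigma> p}) \<longleftrightarrow>
    (\<forall>T\<in>orbit (arcs.step \<sigma>) ` (semi_arcs D \<times> UNIV). (\<Sum>e\<in>T. weight (arc_rise \<phi>') e) = 0)"
  proof (rule arcs.parity_defect[where v = "out_val \<phi>'"])
    show "odd (out_val \<phi>' (oth a) - out_val \<phi>' a)" if "a \<in> nonoriented \<sigma>" for a
      by (rule odd_rise_nonoriented[OF nc' that])
  qed (rule card_moved card_nonoriented arc_rise_def arc_rise_two_cuts[OF nc' xy])+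
  moreover have "(\<Sum>e\<in>T. weight (arc_rise \<phi>') e) = 0 \<longleftrightarrow> index D C T = 0"
    if T: "T \<in> traversals D \<sigma>" for T
  proof -
    obtain e where e: "e \<in> semi_arcs D \<times> UNIV" "T = orbit (arcs.step \<sigma>) e"
      using T unfolding traversals_eq by blast
    have "even (\<Sum>f\<in>T. weight (arc_rise \<phi>') f)"
      unfolding e(2) arc_rise_def[abs_def]
      by (rule arcs.weight_sum_even[OF e(1)]) (rule odd_rise_nonoriented[OF nc'])
    \<comment> \<open>The sum is even, so halving it with \<open>div\<close> cannot turn a nonzero
      sum into index 0.\<close>
    then obtain k where k: "(\<Sum>f\<in>T. weight (arc_rise \<phi>') f) = 2 * k" by (elim evenE)
    have "nat \<bar>2 * k\<bar> div 2 = nat \<bar>k\<bar>" by (simp add: abs_mult nat_mult_distrib)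
    then show ?thesis unfolding index_eq[OF nc nc' T] k by simp
  qed
  then have "(\<forall>T\<in>traversals D \<sigma>. (\<Sum>e\<in>T. weight (arc_rise \<phi>') e) = 0) \<longleftrightarrow>
      (\<forall>T\<in>traversals D \<sigma>. index D C T = 0)"
    by (rule ball_cong[OF refl])
  ultimately show ?thesis by (simp only: sharp_eq num_orbits_nxt traversals_eq)
qed

end

section \<open>Numerical data of a single state\<close>

context link_diagram begin

lemma cut_system_numbered: "cut_system D C \<Longrightarrow> \<exists>\<phi>. numbered_cuts C \<phi>"
  using classical_crossings
  unfolding cut_system_def oriented_cut_points_def numbered_cuts_def passages_def by blast

lemma tau_eq_0_iff: "tau D C i \<sigma> = 0 \<longleftrightarrow> (\<forall>T\<in>traversals D \<sigma>. index D C T \<noteq> i)"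
  unfolding tau_def loops_of_index_def using finite_traversals by auto

lemma finite_tau: "finite {i. i \<ge> 1 \<and> tau D C i \<sigma> \<noteq> 0}"
proof (rule finite_subset)
  show "{i. i \<ge> 1 \<and> tau D C i \<sigma> \<noteq> 0} \<subseteq> index D C ` traversals D \<sigma>"
    by (auto simp: tau_eq_0_iff)
qed (simp add: finite_traversals)

text \<open>This makes the subtraction in the exponent \<open>sharp D \<sigma> - 1\<close> a genuine
  one.\<close>

lemma sharp_pos: "sharp D \<sigma> \<ge> 1"
proof -
  have "components D \<ge> 1" using diagram by (simp add: virtual_link_diagram_def)
  then have "semi_arcs D \<noteq> {}" using num_orbits_nxt by (auto simp: num_orbits_def)
  then have "loops D \<sigma> \<noteq> {}" by (simp add: loops_def traversals_def)
  moreover have "finite (loops D \<sigma>)" using finite_traversals by (simp add: loops_def)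
  ultimately show ?thesis by (simp add: sharp_def Suc_le_eq card_gt_0_iff)
qed

text \<open>A smoothing contributes the sign of its crossing to \<open>natural\<close> if it
  respects the orientation, and minus the sign otherwise. As signs are odd, twice a sum of signs is
  modulo 4 twice the number of its terms.\<close>

lemma natural_writhe:
  assumes "\<sigma> \<in> states D"
  shows "4 dvd natural D \<sigma> - writhe D - 2 * int (card {p \<in> classical D. \<not> respects_orientation D \<sigma> p})"
    "even (writhe D - int (card (classical D)))"
proof -
  let ?N = "{p \<in> classical D. \<not> respects_orientation D \<sigma> p}"
  let ?s = "crossing_sign D"
  note fin = finite_classical
  have sign: "?s p = 1 \<or> ?s p = -1" for p by (simp add: crossing_sign_def Let_def)
  have "natural D \<sigma> = (\<Sum>p\<in>classical D. of_bool (\<sigma> p = A_splice) - of_bool (\<sigma> p = B_splice))"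
    unfolding natural_def using fin by (simp add: sum_subtractf Int_def)
  also have "\<dots> = (\<Sum>p\<in>classical D. ?s p - (if \<not> respects_orientation D \<sigma> p then 2 * ?s p else 0))"
  proof (rule sum.cong[OF refl])
    fix p
    show "of_bool (\<sigma> p = A_splice) - of_bool (\<sigma> p = B_splice)
        = ?s p - (if \<not> respects_orientation D \<sigma> p then 2 * ?s p else 0)"
      using sign[of p] by (cases "\<sigma> p") (auto simp: respects_orientation_def)
  qed
  also have "\<dots> = writhe D - 2 * (\<Sum>p\<in>?N. ?s p)"
    unfolding writhe_def sum_subtractf using fin
    by (simp add: sum.inter_filter[symmetric] sum_distrib_left)
  finally have nat: "natural D \<sigma> = writhe D - 2 * (\<Sum>p\<in>?N. ?s p)" .
  have "even (\<Sum>p\<in>?N. ?s p - 1)"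
  proof (rule dvd_sum)
    show "even (?s p - 1)" for p using sign[of p] by auto
  qed
  then have "even (- (\<Sum>p\<in>?N. ?s p) - int (card ?N))" by (simp add: sum_subtractf)
  then have "2 * 2 dvd 2 * (- (\<Sum>p\<in>?N. ?s p) - int (card ?N))"
    by (rule mult_dvd_mono[OF dvd_refl])
  then show "4 dvd natural D \<sigma> - writhe D - 2 * int (card ?N)" by (simp add: nat algebra_simps)
  have "even (\<Sum>p\<in>classical D. ?s p - 1)"
  proof (rule dvd_sum)
    show "even (?s p - 1)" for p using sign[of p] by auto
  qed
  then show "even (writhe D - int (card (classical D)))" by (simp add: sum_subtractf writhe_def)
qed

end

section \<open>Exponents of the multivariable polynomial\<close>

text \<open>The exponents 2 and -2 in the loop factor agree modulo 4. This makes the term of a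
  single state homogeneous, and the property is additive under products.\<close>

definition concentrated :: "int \<Rightarrow> (nat \<Rightarrow>\<^sub>0 nat) \<Rightarrow> mpoly \<Rightarrow> bool" where
  "concentrated r \<mu> g \<longleftrightarrow> (\<forall>(k, m) \<in> Poly_Mapping.keys g. 4 dvd k - r \<and> m = \<mu>)"

lemma concentrated_mult:
  assumes "concentrated r \<mu> f" "concentrated s \<nu> g"
  shows "concentrated (r + s) (\<mu> + \<nu>) (f * g)"
  unfolding concentrated_def
proof
  fix x assume "x \<in> Poly_Mapping.keys (f * g)"
  then obtain a b where ab: "a \<in> Poly_Mapping.keys f" "b \<in> Poly_Mapping.keys g" "x = a + b"
    using keys_mult[of f g] by blast
  have a: "4 dvd fst a - r" "snd a = \<mu>" and b: "4 dvd fst b - s" "snd b = \<nu>"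
    using assms ab unfolding concentrated_def by (auto simp: split_beta)
  have "4 dvd (fst a - r) + (fst b - s)" using a b by (intro dvd_add)
  then show "case x of (k, m) \<Rightarrow> 4 dvd k - (r + s) \<and> m = \<mu> + \<nu>"
    using ab(3) a b by (simp add: split_beta algebra_simps)
qed

lemma concentrated_cong: "concentrated r \<mu> g \<Longrightarrow> 4 dvd r - s \<Longrightarrow> concentrated s \<mu> g"
  unfolding concentrated_def by (auto dest: dvd_add)

lemma concentrated_1: "concentrated 0 0 1"
  by (simp add: concentrated_def zero_prod_def)

lemma concentrated_power:
  "concentrated r 0 g \<Longrightarrow> concentrated (int n * r) 0 (g ^ n)"
proof (induction n)
  case (Suc n)
  then show ?case using concentrated_mult[of r 0 g "int n * r" 0 "g ^ n"] by (simp add: algebra_simps)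
qed (simp add: concentrated_1)

lemma concentrated_d_power: "concentrated 0 (Poly_Mapping.single i n) (d_var i ^ n)"
proof (induction n)
  case (Suc n)
  have "concentrated 0 (Poly_Mapping.single i 1) (d_var i)"
    by (simp add: concentrated_def d_var_def)
  from concentrated_mult[OF this Suc] show ?case by (simp flip: single_add)
qed (simp add: concentrated_1)

lemma concentrated_prod:
  "(\<And>i. i \<in> I \<Longrightarrow> concentrated 0 (\<mu> i) (g i)) \<Longrightarrow> concentrated 0 (\<Sum>i\<in>I. \<mu> i) (\<Prod>i\<in>I. g i)"
proof (induction I rule: infinite_finite_induct)
  case (insert i I)
  then show ?case using concentrated_mult[of 0 "\<mu> i" "g i" 0] by simp
qed (simp_all add: concentrated_1)

lemma concentrated_A: "concentrated k 0 (A_pow k)"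
  by (simp add: concentrated_def A_pow_def)

lemma concentrated_uminus: "concentrated r \<mu> g \<Longrightarrow> concentrated r \<mu> (- g)"
  by (simp add: concentrated_def)

lemma concentrated_diff:
  assumes "concentrated r \<mu> f" "concentrated r \<mu> g"
  shows "concentrated r \<mu> (f - g)"
  unfolding concentrated_def
proof
  fix x assume "x \<in> Poly_Mapping.keys (f - g)"
  then have "x \<in> Poly_Mapping.keys f \<union> Poly_Mapping.keys g" by (rule subsetD[OF keys_diff])
  then show "case x of (k, m) \<Rightarrow> 4 dvd k - r \<and> m = \<mu>"
    using assms unfolding concentrated_def by (elim UnE) (drule (1) bspec, assumption)+
qed

lemma concentrated_minus_A3_pow: "concentrated (3 * k) 0 (minus_A3_pow k)"
proof (cases "k \<ge> 0")
  case True
  then show ?thesis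
    using concentrated_power[OF concentrated_uminus[OF concentrated_A[of 3]], of "nat k"]
    by (simp add: minus_A3_pow_def mult.commute)
next
  case False
  then show ?thesis
    using concentrated_power[OF concentrated_uminus[OF concentrated_A[of "-3"]], of "nat (- k)"]
    by (simp add: minus_A3_pow_def mult.commute)
qed

text \<open>A monomial with nonzero coefficient in a sum occurs in one of the summands, whatever
  cancels between different states.\<close>

lemma X_poly_monomial:
  assumes "Poly_Mapping.lookup (X_poly D C) (k, m) \<noteq> 0"
  obtains \<sigma> where "\<sigma> \<in> states D"
    "4 dvd k - (natural D \<sigma> + 2 * int (sharp D \<sigma> - 1) - 3 * writhe D)"
    "m = (\<Sum>i \<in> {i. i \<ge> 1 \<and> tau D C i \<sigma> \<noteq> 0}. Poly_Mapping.single i (tau D C i \<sigma>))"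
proof -
  let ?I = "\<lambda>\<sigma>. {i. i \<ge> 1 \<and> tau D C i \<sigma> \<noteq> 0}"
  let ?t = "\<lambda>\<sigma>. A_pow (natural D \<sigma>) * (- A_pow 2 - A_pow (-2)) ^ (sharp D \<sigma> - 1) *
        (\<Prod>i \<in> ?I \<sigma>. d_var i ^ tau D C i \<sigma>)"
  have two: "concentrated 2 0 (- A_pow 2 - A_pow (-2))"
    by (intro concentrated_diff concentrated_uminus concentrated_A
        concentrated_cong[OF concentrated_A[of "-2"]]) simp
  have conc: "concentrated (3 * (- writhe D) + (natural D \<sigma> + int (sharp D \<sigma> - 1) * 2 + 0))
      (0 + (0 + 0 + (\<Sum>i \<in> ?I \<sigma>. Poly_Mapping.single i (tau D C i \<sigma>))))
      (minus_A3_pow (- writhe D) * ?t \<sigma>)" for \<sigma>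
    by (intro concentrated_mult concentrated_minus_A3_pow concentrated_A concentrated_power[OF two]
        concentrated_prod concentrated_d_power)
  have eq: "Poly_Mapping.lookup (X_poly D C) (k, m)
      = (\<Sum>\<sigma>\<in>states D. Poly_Mapping.lookup (minus_A3_pow (- writhe D) * ?t \<sigma>) (k, m))"
    by (simp add: X_poly_def double_bracket_def sum_distrib_left lookup_sum)
  obtain \<sigma> where \<sigma>: "\<sigma> \<in> states D"
    "Poly_Mapping.lookup (minus_A3_pow (- writhe D) * ?t \<sigma>) (k, m) \<noteq> 0"
    by (rule sum.not_neutral_contains_not_neutral[OF assms[unfolded eq]])
  then have "(k, m) \<in> Poly_Mapping.keys (minus_A3_pow (- writhe D) * ?t \<sigma>)"
    by (simp only: in_keys_iff not_False_eq_True)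
  then have "4 dvd k - (3 * (- writhe D) + (natural D \<sigma> + int (sharp D \<sigma> - 1) * 2 + 0))
      \<and> m = 0 + (0 + 0 + (\<Sum>i \<in> ?I \<sigma>. Poly_Mapping.single i (tau D C i \<sigma>)))"
    using conc[of \<sigma>] unfolding concentrated_def by blast
  then show thesis using that[OF \<sigma>(1)] by (simp add: algebra_simps)
qed

lemma (in link_diagram) X_poly_exponent:
  assumes "cut_system D C" and nc': "numbered_cuts [x \<mapsto> Along, y \<mapsto> Against] \<phi>'" and xy: "x \<noteq> y"
    and k: "Poly_Mapping.lookup (X_poly D C) (k, m) \<noteq> 0"
  shows "m = 0 \<Longrightarrow> 4 dvd k - 2 * (int (components D) - 1)"
    and "Poly_Mapping.lookup m 1 \<noteq> 0 \<Longrightarrow> 4 dvd k - 2 * int (components D)"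
proof -
  obtain \<phi> where nc: "numbered_cuts C \<phi>" using cut_system_numbered assms(1) by blast
  from k obtain \<sigma> where \<sigma>: "\<sigma> \<in> states D"
    "4 dvd k - (natural D \<sigma> + 2 * int (sharp D \<sigma> - 1) - 3 * writhe D)"
    "m = (\<Sum>i \<in> {i. i \<ge> 1 \<and> tau D C i \<sigma> \<noteq> 0}. Poly_Mapping.single i (tau D C i \<sigma>))"
    by (rule X_poly_monomial)
  define q where "q = card {p \<in> classical D. \<not> respects_orientation D \<sigma> p}"
  define N where "N = card (classical D)"
  define s where "s = sharp D \<sigma>"
  have s1: "int (s - 1) = int s - 1" using sharp_pos[of \<sigma>] by (simp add: s_def)
  have a: "4 dvd k - (natural D \<sigma> + 2 * (int s - 1) - 3 * writhe D)"
    using \<sigma>(2) s1 by (simp add: s_def)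
  have b: "4 dvd natural D \<sigma> - writhe D - 2 * int q"
    using natural_writhe(1)[OF \<sigma>(1)] by (simp add: q_def)
  have c: "even (writhe D - int N)" using natural_writhe(2)[OF \<sigma>(1)] by (simp add: N_def)
  \<comment> \<open>Modulo 4 the exponent is \<open>2 * (s + q - 1) - 2 * writhe D\<close>, and the
    writhe has the parity of \<open>N\<close>.\<close>
  have k': "4 dvd k - 2 * (int s + int q + int N - 1)"
    using a b c by presburger
  have parity: "even (s + components D + N + q) \<longleftrightarrow> (\<forall>T\<in>traversals D \<sigma>. index D C T = 0)"
    using parity_of_loops[OF nc nc' xy] by (simp add: s_def N_def q_def)
  have m: "Poly_Mapping.lookup m i = (if i \<ge> 1 then tau D C i \<sigma> else 0)" for i
    unfolding \<sigma>(3) using finite_tau[of C \<sigma>]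
    by (auto simp: lookup_sum lookup_single when_def)
  \<comment> \<open>If \<open>m\<close> is 0, all loops have index 0, so \<open>s + q + N\<close>
    has the parity of the number of components.\<close>
  show "4 dvd k - 2 * (int (components D) - 1)" if "m = 0"
  proof -
    have tau0: "tau D C i \<sigma> = 0" if "i \<ge> 1" for i using m[of i] that \<open>m = 0\<close> by simp
    have "index D C T = 0" if T: "T \<in> traversals D \<sigma>" for T
    proof (rule ccontr)
      assume "index D C T \<noteq> 0"
      then have "tau D C (index D C T) \<sigma> = 0" using tau0 by simp
      from bspec[OF iffD1[OF tau_eq_0_iff this] T] show False by simp
    qed
    then have "even (s + components D + N + q)" using parity by blast
    then have "even (int s + int (components D) + int N + int q)" by presburger
    then show ?thesis using k' by presburger
  qed
  \<comment> \<open>A positive power of \<open>d_var 1\<close> comes from a loop of index 1, which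
    gives the opposite parity.\<close>
  show "4 dvd k - 2 * int (components D)" if "Poly_Mapping.lookup m 1 \<noteq> 0"
  proof -
    have "tau D C 1 \<sigma> \<noteq> 0" using m[of 1] that by simp
    then obtain T where T: "T \<in> traversals D \<sigma>" "index D C T = 1" by (auto simp: tau_eq_0_iff)
    have "\<not> (\<forall>T\<in>traversals D \<sigma>. index D C T = 0)"
    proof
      assume "\<forall>T\<in>traversals D \<sigma>. index D C T = 0"
      from bspec[OF this T(1)] T(2) show False by simp
    qed
    then have "odd (s + components D + N + q)" using parity by simp
    then have "odd (int s + int (components D) + int N + int q)" by presburger
    then show ?thesis using k' by presburger
  qed
qed

section \<open>Virtualizing a crossing of an almost classical diagram\<close>

lemma virtualize_simps:
  "components (virtualize D c) = components D" "points (virtualize D c) = points D"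
  "position (virtualize D c) = position D" "velocity (virtualize D c) = velocity D"
  "preimages (virtualize D c) = preimages D" "crossings (virtualize D c) = crossings D"
  "classical (virtualize D c) = classical D - {c}" "curve (virtualize D c) = curve D"
  by (auto simp: virtualize_def points_def position_def[abs_def] velocity_def[abs_def]
      preimages_def[abs_def] crossings_def classical_def)

lemma virtual_link_diagram_virtualize:
  "virtual_link_diagram D \<Longrightarrow> virtual_link_diagram (virtualize D c)"
  unfolding virtual_link_diagram_def virtualize_simps
  by (elim conjE, intro conjI) (simp_all add: virtualize_def)

text \<open>With both strands drawn upward, the number increases along one strand of the virtualized
  crossing and decreases along the other.\<close>

lemma virtualize_numbered_cuts:
  assumes vld: "virtual_link_diagram D" and ac: "almost_classical D" and c: "c \<in> classical D"
  obtains x y \<phi> where "x \<noteq> y"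
    "link_diagram.numbered_cuts (virtualize D c) [x \<mapsto> Along, y \<mapsto> Against] \<phi>"
proof -
  interpret D: link_diagram D by unfold_locales (rule vld)
  interpret V: link_diagram "virtualize D c"
    by unfold_locales (rule virtual_link_diagram_virtualize[OF vld])
  obtain u v where uv: "preimages D c = {u, v}" "u \<noteq> v"
    using D.card_preimages[OF c] by (auto simp only: card_2_iff)
  have "det2 (velocity D u) (velocity D v) \<noteq> 0" by (rule D.det2_nonzero[of _ c]) (use uv in auto)
  moreover have "det2 (velocity D v) (velocity D u) = - det2 (velocity D u) (velocity D v)"
    by (simp add: det2_def)
  \<comment> \<open>The strand through \<open>x\<close> runs from bottom-left to top-right, so the
    numbering rises along it and falls along the strand through \<open>y\<close>.\<close>
  ultimately obtain x y where xy: "preimages D c = {x, y}" "x \<noteq> y"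
    "det2 (velocity D x) (velocity D y) > 0"
    using uv by (metis insert_commute linorder_neqE_linordered_idom neg_0_less_iff_less)
  obtain \<phi> where \<phi>: "alexander_numbering D Map.empty \<phi>" using ac by (auto simp: almost_classical_def)
  let ?C = "[x \<mapsto> Along, y \<mapsto> Against]"
  have xyc: "x \<in> points D" "y \<in> points D" "position D x = c" "position D y = c"
    using xy(1) by (auto simp: preimages_def)
  have z: "z \<in> points D \<Longrightarrow> position D z = c \<Longrightarrow> z = x \<or> z = y" for z
    using xy(1) by (auto simp: preimages_def)
  have dom: "dom ?C = {x, y}" by auto
  \<comment> \<open>The cut points replace the two lost passages, so the pieces are those of the
    original diagram and its numbering can be kept.\<close>
  have "passages (virtualize D c) \<union> dom ?C = passages D"
    unfolding dom passages_def virtualize_simps using xyc z c by auto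
  then have M: "passages (virtualize D c) \<union> dom ?C = passages D \<union> dom (Map.empty :: cuts)" by simp
  let ?M = "passages D \<union> dom (Map.empty :: cuts)"
  have num: "\<exists>i. \<phi> (incoming ?M x') = i \<and> \<phi> (outgoing y') = i \<and>
      \<phi> (incoming ?M y') = i + 1 \<and> \<phi> (outgoing x') = i + 1"
    if "p \<in> classical D" "x' \<in> preimages D p" "y' \<in> preimages D p" "x' \<noteq> y'"
      "det2 (velocity D x') (velocity D y') > 0" for p x' y'
    using \<phi> that unfolding alexander_numbering_def Let_def by blast
  have nx: "\<phi> (outgoing x) = \<phi> (incoming ?M x) + 1" "\<phi> (incoming ?M y) = \<phi> (outgoing y) + 1"
    using num[OF c, of x y] xy by auto
  have "alexander_numbering (virtualize D c) ?C \<phi>"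
    unfolding alexander_numbering_def Let_def M virtualize_simps
  proof (intro conjI ballI impI allI)
    fix p x' y'
    assume "p \<in> classical D - {c}" "x' \<in> preimages D p" "y' \<in> preimages D p"
      "x' \<noteq> y' \<and> det2 (velocity D x') (velocity D y') > 0"
    then show "\<exists>i. \<phi> (incoming ?M x') = i \<and> \<phi> (outgoing y') = i \<and>
      \<phi> (incoming ?M y') = i + 1 \<and> \<phi> (outgoing x') = i + 1"
      using num[of p x' y'] by blast
  next
    fix z assume "?C z = Some Along"
    then have "z = x" using xy(2) by (auto split: if_splits)
    then show "\<phi> (outgoing z) = \<phi> (incoming ?M z) + 1" using nx by simp
  next
    fix z assume "?C z = Some Against"
    then have "z = y" by (auto split: if_splits)
    then show "\<phi> (incoming ?M z) = \<phi> (outgoing z) + 1" using nx by simp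
  qed
  moreover have "dom ?C \<inter> passages (virtualize D c) = {}"
    unfolding dom passages_def virtualize_simps using xyc by auto
  ultimately have "V.numbered_cuts ?C \<phi>"
    unfolding V.numbered_cuts_def virtualize_simps dom using xyc by auto
  then show thesis by (rule that[OF xy(2)])
qed

theorem corollary3p5:
  fixes D\<^sub>0 D :: diagram and c :: plane and C :: cuts and n :: nat
  assumes "virtual_link_diagram D\<^sub>0"
    and "almost_classical D\<^sub>0"
    and "c \<in> classical D\<^sub>0"
    and "D = virtualize D\<^sub>0 c"
    and "n = components D"
    and "cut_system D C"
  shows "Exp (X_poly D C) \<subseteq>
           (if odd n then {4 * k | k. True} else {4 * k + 2 | k. True}) \<and>
         Exp_with (X_poly D C) 1 \<subseteq>
           (if odd n then {4 * k + 2 | k. True} else {4 * k | k. True})"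
proof -
  interpret link_diagram D
    using virtual_link_diagram_virtualize[OF assms(1)] assms(4) by unfold_locales simp
  obtain x y \<phi> where xy: "x \<noteq> y" "numbered_cuts [x \<mapsto> Along, y \<mapsto> Against] \<phi>"
    using virtualize_numbered_cuts[OF assms(1-3)] assms(4) by metis
  have "k \<in> (if odd n then {4 * k | k. True} else {4 * k + 2 | k. True})"
    if "k \<in> Exp (X_poly D C)" for k
  proof -
    have "4 dvd k - 2 * (int n - 1)"
      using X_poly_exponent(1)[OF assms(6) xy(2,1)] that assms(5) by (simp add: Exp_def)
    then show ?thesis by simp presburger
  qed
  moreover have "k \<in> (if odd n then {4 * k + 2 | k. True} else {4 * k | k. True})"
    if "k \<in> Exp_with (X_poly D C) 1" for k
  proof -
    have "4 dvd k - 2 * int n"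
      using X_poly_exponent(2)[OF assms(6) xy(2,1)] that assms(5) by (auto simp: Exp_with_def)
    then show ?thesis by simp presburger
  qed
  ultimately show ?thesis by blast
qed

end
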